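(* There exist simplicial complexes $K$ and $L$, with $L$ shifted, such that $\Delta(K*L)\neq\Delta(\Delta(K)*\Delta(L))$. Specifically, let $B$ be the graph (1-dimensional simplicial complex) consisting of two disjoint edges on four vertices, and let $\Sigma$ denote suspension (join with the complex consisting of two points). Then $$\Delta(\Sigma(B))\setminus\Delta(\Sigma(\Delta(B)))=\{\{1,2,6\}\}\quad\text{and}\quad \Delta(\Sigma(\Delta(B)))\setminus\Delta(\Sigma(B))=\{\{1,3,4\}\}.$$
   Context: Simplicial complexes are finite and contain the empty set. For a complex $K$, $K_0$ denotes its vertex set. $[n]=\{1,\dots,n\}$. The join of complexes on disjoint vertex sets is $K*L=\{S\cup T: S\in K, T\in L\}$; in a join of complexes whose vertex sets are not disjoint, they are first relabelled to be disjoint. The suspension $\Sigma K$ is the join of $K$ with the complex $\{\emptyset,\{x\},\{y\}\}$ on two new vertices. A simplicial complex on vertex set $[m]$ is shifted if whenever $j\in S\in K$, $i<j$, $i\notin S$, also $(S\setminus\{j\})\cup\{i\}\in K$. Lexicographic order: for sets $S\ne T$ of positive integers of equal size, $S<_L T$ iff $\min(S\triangle T)\in S$. Algebraic shifting (exterior): let $K$ be a simplicial complex with vertex set contained in $[n]$ (label the vertices by positive integers if necessary). Let $V$ be a real vector space with basis $e_1,\dots,e_n$, and let $f_i=\sum_{j=1}^n\alpha_{ij}e_j$, $1\le i\le n$, where the $n^2$ real numbers $\alpha_{ij}$ are algebraically independent over $\mathbb{Q}$. For $S=\{s_1<\dots<s_k\}\subseteq[n]$ put $e_S=e_{s_1}\wedge\dots\wedge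 e_{s_k}$, $f_S=f_{s_1}\wedge\dots\wedge f_{s_k}$ in $\bigwedge V$, and let $\tilde f_S$ be the image of $f_S$ in $(\bigwedge V)/(e_T: T\subseteq[n],\,T\notin K)$. Then $$\Delta(K)=\{S\subseteq[n]:\ \tilde f_S\notin \mathrm{span}\{\tilde f_{S'}: |S'|=|S|,\ S'<_L S\}\}.$$ $\Delta(K)$ does not depend on the choice of the generic matrix, of $n$, or of the vertex labelling; it is a simplicial complex with vertex set $\{1,\dots,|K_0|\}$. *)

theory Defs
  imports Complex_Main "HOL-Library.Function_Algebras" "HOL-Library.Poly_Mapping"
begin

definition abstract_simplicial_complex :: "'a set set \<Rightarrow> bool" where
  "abstract_simplicial_complex K \<longleftrightarrow>
     finite K \<and> {} \<in> K \<and> (\<forall>S\<in>K. finite S) \<and> (\<forall>S\<in>K. \<forall>T. T \<subseteq> S \<longrightarrow> T \<in> K)"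

definition vertices :: "'a set set \<Rightarrow> 'a set" where
  "vertices K = {v. {v} \<in> K}"

text \<open>The relabelling that makes the vertex sets disjoint is the canonical one, into the
  disjoint sum of the vertex types.\<close>

definition simplicial_join :: "'a set set \<Rightarrow> 'b set set \<Rightarrow> ('a + 'b) set set" where
  "simplicial_join K L = {S <+> T | S T. S \<in> K \<and> T \<in> L}"

definition two_points :: "nat set set" where
  "two_points = {{}, {1}, {2}}"

definition suspension :: "'a set set \<Rightarrow> ('a + nat) set set" where
  "suspension K = simplicial_join K two_points"

definition two_disjoint_edges :: "nat set set" where
  "two_disjoint_edges = {{}, {1}, {2}, {3}, {4}, {1, 2}, {3, 4}}"

definition shifted :: "nat set set \<Rightarrow> bool" where
  "shifted K \<longleftrightarrow> (\<exists>m. vertices K = {1..m} \<and>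
     (\<forall>S\<in>K. \<forall>j\<in>S. \<forall>i\<in>{1..m}. i < j \<and> i \<notin> S \<longrightarrow> (S - {j}) \<union> {i} \<in> K))"

definition lex_less :: "nat set \<Rightarrow> nat set \<Rightarrow> bool" where
  "lex_less S T \<longleftrightarrow> card S = card T \<and> S \<noteq> T \<and> Min (sym_diff S T) \<in> S"


text \<open>Algebraic independence over the rationals of a family of reals indexed by \<open>I\<close>.
  A polynomial with rational coefficients in variables of type \<open>'i\<close> is an element of
  \<open>('i \<Rightarrow>\<^sub>0 nat) \<Rightarrow>\<^sub>0 rat\<close>: finitely many monomials (exponent vectors), with coefficients.\<close>

definition poly_eval :: "('i \<Rightarrow> real) \<Rightarrow> (('i \<Rightarrow>\<^sub>0 nat) \<Rightarrow>\<^sub>0 rat) \<Rightarrow> real" where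
  "poly_eval x p =
     (\<Sum>m\<in>Poly_Mapping.keys p.
        of_rat (Poly_Mapping.lookup p m) *
        (\<Prod>i\<in>Poly_Mapping.keys m. x i ^ Poly_Mapping.lookup m i))"

definition alg_independent :: "'i set \<Rightarrow> ('i \<Rightarrow> real) \<Rightarrow> bool" where
  "alg_independent I x \<longleftrightarrow>
     (\<forall>p. (\<forall>m\<in>Poly_Mapping.keys p. Poly_Mapping.keys m \<subseteq> I) \<and> poly_eval x p = 0 \<longrightarrow> p = 0)"


text \<open>An element of the exterior algebra is represented by its coordinates with respect to the
  basis \<open>e\<^sub>S\<close>, so it is a function \<open>nat set \<Rightarrow> real\<close>.\<close>

instantiation "fun" :: (type, real_vector) real_vector
begin

definition scaleR_fun :: "real \<Rightarrow> ('a \<Rightarrow> 'b) \<Rightarrow> 'a \<Rightarrow> 'b" where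
  "scaleR_fun c f = (\<lambda>x. c *\<^sub>R f x)"

instance
  by standard (auto simp: scaleR_fun_def fun_eq_iff scaleR_add_right scaleR_add_left)

end

definition e_basis :: "nat set \<Rightarrow> nat set \<Rightarrow> real" where
  "e_basis S = (\<lambda>T. if T = S then 1 else 0)"

text \<open>For disjoint \<open>S\<close> and \<open>T\<close> we have \<open>e\<^sub>S \<and> e\<^sub>T = shuffle_sign S T \<cdot> e\<^bsub>S \<union> T\<^esub>\<close>, the sign being
  that of the permutation which sorts \<open>S\<close> followed by \<open>T\<close>; otherwise \<open>e\<^sub>S \<and> e\<^sub>T = 0\<close>.\<close>

definition shuffle_sign :: "nat set \<Rightarrow> nat set \<Rightarrow> real" where
  "shuffle_sign S T = (- 1) ^ card {(s, t). s \<in> S \<and> t \<in> T \<and> t < s}"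

definition wedge :: "(nat set \<Rightarrow> real) \<Rightarrow> (nat set \<Rightarrow> real) \<Rightarrow> (nat set \<Rightarrow> real)" where
  "wedge x y = (\<lambda>U. \<Sum>S\<in>Pow U. shuffle_sign S (U - S) * x S * y (U - S))"

definition exterior_algebra :: "nat \<Rightarrow> (nat set \<Rightarrow> real) set" where
  "exterior_algebra n = span (e_basis ` Pow {1..n})"

text \<open>The two-sided ideal of the exterior algebra generated by the non-faces of \<open>K\<close>.\<close>

definition face_ideal :: "nat \<Rightarrow> nat set set \<Rightarrow> (nat set \<Rightarrow> real) set" where
  "face_ideal n K = span {wedge (wedge x (e_basis T)) y | x y T.
     x \<in> exterior_algebra n \<and> y \<in> exterior_algebra n \<and> T \<subseteq> {1..n} \<and> T \<notin> K}"

definition f_vec :: "nat \<Rightarrow> (nat \<Rightarrow> nat \<Rightarrow> real) \<Rightarrow> nat \<Rightarrow> nat set \<Rightarrow> real" where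
  "f_vec n \<alpha> i = (\<Sum>j\<in>{1..n}. \<alpha> i j *\<^sub>R e_basis {j})"

definition f_wedge :: "nat \<Rightarrow> (nat \<Rightarrow> nat \<Rightarrow> real) \<Rightarrow> nat set \<Rightarrow> nat set \<Rightarrow> real" where
  "f_wedge n \<alpha> S = foldr wedge (map (f_vec n \<alpha>) (sorted_list_of_set S)) (e_basis {})"

definition generic_matrix :: "nat \<Rightarrow> (nat \<Rightarrow> nat \<Rightarrow> real) \<Rightarrow> bool" where
  "generic_matrix n \<alpha> \<longleftrightarrow> alg_independent ({1..n} \<times> {1..n}) (\<lambda>(i, j). \<alpha> i j)"

text \<open>The residue class of \<open>f\<^sub>S\<close> modulo the ideal lies in the span of the residue classes of
  certain \<open>f\<^bsub>S'\<^esub>\<close> iff \<open>f\<^sub>S\<close> is congruent to some element \<open>g\<close> of the span of these \<open>f\<^bsub>S'\<^esub>\<close>.\<close>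

definition shift_wrt :: "nat \<Rightarrow> (nat \<Rightarrow> nat \<Rightarrow> real) \<Rightarrow> nat set set \<Rightarrow> nat set set" where
  "shift_wrt n \<alpha> K = {S. S \<subseteq> {1..n} \<and>
     \<not> (\<exists>g \<in> span {f_wedge n \<alpha> S' | S'. S' \<subseteq> {1..n} \<and> card S' = card S \<and> lex_less S' S}.
          f_wedge n \<alpha> S - g \<in> face_ideal n K)}"

text \<open>The result does not depend on \<open>n\<close>, on the generic matrix \<open>\<alpha>\<close>, or on the labelling \<open>l\<close> of the
  vertices by positive integers; it is the common value for all choices.\<close>

definition alg_shift :: "'a set set \<Rightarrow> nat set set" where
  "alg_shift K = (THE D. \<exists>n \<alpha> l. inj_on l (vertices K) \<and> l ` vertices K \<subseteq> {1..n} \<and>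
     generic_matrix n \<alpha> \<and> D = shift_wrt n \<alpha> ((`) l ` K))"

end

theory Submission
  imports Defs "HOL-Analysis.Continuum_Not_Denumerable" "HOL-Computational_Algebra.Polynomial"
begin

text \<open>
  Modulo the non-faces, the coordinates of \<open>f\<^sub>S\<close> are the minors of the generic matrix with rows \<open>S\<close>
  and columns the faces of \<open>K\<close>, so that \<open>\<Delta>(K)\<close> is the lexicographically greedy basis among the
  rows of minors. A set of rows is independent at a generic matrix as soon as it is independent at
  one matrix. For the complexes at hand there are as many rows in the claimed shifting as faces, so
  independence also shows that the later rows are dependent; the earlier dependent rows are
  treated by hand. In dimension two the suspensions differ as follows. For \<open>\<Delta>(B)\<close>, with edges
  \<open>12\<close> and \<open>13\<close> sharing a vertex, a Pluecker relation makes the rows \<open>{1, 2, j}\<close> span only three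
  dimensions, so that \<open>126\<close> is replaced by \<open>134\<close>; for the disjoint edges \<open>12\<close> and \<open>34\<close> the rows
  \<open>123\<close>, \<open>124\<close>, \<open>125\<close>, \<open>126\<close> are independent.
\<close>

section \<open>Generic points\<close>

text \<open>\<open>alg_shift\<close> is a \<open>THE\<close> over all sizes \<open>n\<close>,
  generic matrices and labellings. It can only be evaluated by computing the shifting for every
  choice at once and by exhibiting one choice, for which algebraically independent reals are
  constructed. This shapes the proof in two ways. Columns are indexed by vertices instead of labels,
  so that one explicit 0/1 matrix certifies independence for all labellings. And \<open>n\<close>
  may exceed the number of vertices, so rows with large entries also have to be shown dependent, on
  smaller rows only. The difference between the two suspensions is a dimension count. With rows 1
  and 2 fixed, the row {1, 2, j} of minors is linear in row j, vanishes for j = 1 and j = 2, and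
  sees only those vertices that lie in triangles. For edges 12 and 34 these are all six vertices,
  which leaves room for 6 - 2 = 4 dimensions. For edges 12 and 13 the vertex 4 lies in no triangle,
  which leaves at most 5 - 2 = 3.\<close>

definition monom_eval :: "('i \<Rightarrow> real) \<Rightarrow> ('i \<Rightarrow>\<^sub>0 nat) \<Rightarrow> real" where
  "monom_eval x m = (\<Prod>i\<in>Poly_Mapping.keys m. x i ^ Poly_Mapping.lookup m i)"

lemma monom_eval_superset:
  assumes "finite A" "Poly_Mapping.keys m \<subseteq> A"
  shows "monom_eval x m = (\<Prod>i\<in>A. x i ^ Poly_Mapping.lookup m i)"
  unfolding monom_eval_def using assms
  by (intro prod.mono_neutral_left) (auto simp: in_keys_iff)

lemma monom_eval_add: "monom_eval x (m + m') = monom_eval x m * monom_eval x m'"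
proof -
  let ?A = "Poly_Mapping.keys m \<union> Poly_Mapping.keys m'"
  have "monom_eval x (m + m') = (\<Prod>i\<in>?A. x i ^ Poly_Mapping.lookup (m + m') i)"
    by (rule monom_eval_superset) (use keys_add[of m m'] in auto)
  also have "\<dots> = (\<Prod>i\<in>?A. x i ^ Poly_Mapping.lookup m i) * (\<Prod>i\<in>?A. x i ^ Poly_Mapping.lookup m' i)"
    by (simp add: lookup_add power_add prod.distrib)
  also have "\<dots> = monom_eval x m * monom_eval x m'"
    by (simp add: monom_eval_superset[of ?A])
  finally show ?thesis .
qed

text \<open>\<open>update i 0 m\<close> is the monomial with the variable \<open>i\<close> erased.
  Splitting off its power allows a polynomial in many variables to be read as a univariate one in
  \<open>t\<close>.\<close>

lemma monom_eval_update:
  "monom_eval (x(i := t)) m =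
     monom_eval x (Poly_Mapping.update i 0 m) * t ^ Poly_Mapping.lookup m i"
proof -
  let ?A = "insert i (Poly_Mapping.keys m)"
  have "monom_eval (x(i := t)) m = (\<Prod>j\<in>?A. (x(i := t)) j ^ Poly_Mapping.lookup m j)"
    by (rule monom_eval_superset) auto
  also have "\<dots> = t ^ Poly_Mapping.lookup m i
      * (\<Prod>j\<in>?A - {i}. (x(i := t)) j ^ Poly_Mapping.lookup m j)"
    by (subst prod.remove[of _ i]) auto
  also have "(\<Prod>j\<in>?A - {i}. (x(i := t)) j ^ Poly_Mapping.lookup m j)
      = (\<Prod>j\<in>?A - {i}. x j ^ Poly_Mapping.lookup (Poly_Mapping.update i 0 m) j)"
    by (intro prod.cong) (auto simp: lookup_update)
  also have "\<dots> = monom_eval x (Poly_Mapping.update i 0 m)"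
    by (rule monom_eval_superset[symmetric]) (auto simp: keys_update)
  finally show ?thesis by (simp only: mult.commute)
qed

lemma poly_eval_superset:
  assumes "finite A" "Poly_Mapping.keys p \<subseteq> A"
  shows "poly_eval x p = (\<Sum>m\<in>A. of_rat (Poly_Mapping.lookup p m) * monom_eval x m)"
  unfolding poly_eval_def monom_eval_def[symmetric] using assms
  by (intro sum.mono_neutral_left) (auto simp: in_keys_iff)

lemma poly_eval_zero [simp]: "poly_eval x 0 = 0"
  by (simp add: poly_eval_def)

lemma poly_eval_add: "poly_eval x (p + q) = poly_eval x p + poly_eval x q"
proof -
  let ?A = "Poly_Mapping.keys p \<union> Poly_Mapping.keys q"
  have "poly_eval x (p + q)
      = (\<Sum>m\<in>?A. of_rat (Poly_Mapping.lookup (p + q) m) * monom_eval x m)"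
    by (rule poly_eval_superset) (use keys_add[of p q] in auto)
  also have "\<dots> = (\<Sum>m\<in>?A. of_rat (Poly_Mapping.lookup p m) * monom_eval x m)
      + (\<Sum>m\<in>?A. of_rat (Poly_Mapping.lookup q m) * monom_eval x m)"
    by (simp add: lookup_add of_rat_add algebra_simps sum.distrib)
  also have "\<dots> = poly_eval x p + poly_eval x q"
    by (simp add: poly_eval_superset[of ?A])
  finally show ?thesis .
qed

lemma poly_eval_sum: "poly_eval x (\<Sum>a\<in>A. p a) = (\<Sum>a\<in>A. poly_eval x (p a))"
  by (induction A rule: infinite_finite_induct) (auto simp: poly_eval_add)

lemma poly_eval_single: "poly_eval x (Poly_Mapping.single m c) = of_rat c * monom_eval x m"
  by (subst poly_eval_superset[of "{m}"]) (auto simp: in_keys_iff lookup_single when_def)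

lemma poly_mapping_eq_sum_single:
  "p = (\<Sum>m\<in>Poly_Mapping.keys p. Poly_Mapping.single m (Poly_Mapping.lookup p m))"
  by (rule poly_mapping_eqI)
     (auto simp: lookup_sum lookup_single when_def in_keys_iff sum.delta)

lemma poly_eval_mult: "poly_eval x (p * q) = poly_eval x p * poly_eval x q"
proof -
  have "p * q = (\<Sum>m\<in>Poly_Mapping.keys p. \<Sum>m'\<in>Poly_Mapping.keys q.
     Poly_Mapping.single (m + m') (Poly_Mapping.lookup p m * Poly_Mapping.lookup q m'))"
    by (subst poly_mapping_eq_sum_single[of p], subst poly_mapping_eq_sum_single[of q])
       (simp add: sum_product mult_single)
  then show ?thesis
    by (simp add: poly_eval_sum poly_eval_single monom_eval_add of_rat_mult
        poly_eval_superset[of "Poly_Mapping.keys p" p] poly_eval_superset[of "Poly_Mapping.keys q" q]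
        sum_product algebra_simps)
qed

text \<open>Integer polynomials in the variables \<open>I\<close>, taken as functions instead of
  syntactic objects: membership of minors and of elimination pivots then follows from the
  introduction rules.\<close>

inductive_set polyfun :: "'i set \<Rightarrow> (('i \<Rightarrow> real) \<Rightarrow> real) set" for I where
  const: "(\<lambda>x. of_int k) \<in> polyfun I"
| var: "i \<in> I \<Longrightarrow> (\<lambda>x. x i) \<in> polyfun I"
| add: "F \<in> polyfun I \<Longrightarrow> G \<in> polyfun I \<Longrightarrow> (\<lambda>x. F x + G x) \<in> polyfun I"
| mult: "F \<in> polyfun I \<Longrightarrow> G \<in> polyfun I \<Longrightarrow> (\<lambda>x. F x * G x) \<in> polyfun I"

lemma polyfun_diff:
  assumes "F \<in> polyfun I" "G \<in> polyfun I"
  shows "(\<lambda>x. F x - G x) \<in> polyfun I"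
  using polyfun.add[OF assms(1) polyfun.mult[OF polyfun.const[of "-1"] assms(2)]] by simp

lemma polyfun_poly_eval:
  assumes "F \<in> polyfun I"
  shows "\<exists>p. (\<forall>m\<in>Poly_Mapping.keys p. Poly_Mapping.keys m \<subseteq> I) \<and> F = (\<lambda>x. poly_eval x p)"
  using assms
proof induction
  case (const k)
  show ?case
    by (rule exI[of _ "Poly_Mapping.single 0 (of_int k)"])
       (auto simp: poly_eval_single monom_eval_def simp del: single_of_int)
next
  case (var i)
  then show ?case
    by (intro exI[of _ "Poly_Mapping.single (Poly_Mapping.single i 1) 1"])
       (auto simp: poly_eval_single monom_eval_def)
next
  case (add F G)
  then obtain p q where "\<forall>m\<in>Poly_Mapping.keys p. Poly_Mapping.keys m \<subseteq> I"
    "F = (\<lambda>x. poly_eval x p)" "\<forall>m\<in>Poly_Mapping.keys q. Poly_Mapping.keys m \<subseteq> I"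
    "G = (\<lambda>x. poly_eval x q)" by auto
  then show ?case
    using keys_add[of p q] by (intro exI[of _ "p + q"]) (auto simp: poly_eval_add)
next
  case (mult F G)
  then obtain p q where p: "\<forall>m\<in>Poly_Mapping.keys p. Poly_Mapping.keys m \<subseteq> I"
    "F = (\<lambda>x. poly_eval x p)" "\<forall>m\<in>Poly_Mapping.keys q. Poly_Mapping.keys m \<subseteq> I"
    "G = (\<lambda>x. poly_eval x q)" by auto
  have "Poly_Mapping.keys m \<subseteq> I" if "m \<in> Poly_Mapping.keys (p * q)" for m
  proof -
    from that keys_mult[of p q] obtain a b
      where "m = a + b" "a \<in> Poly_Mapping.keys p" "b \<in> Poly_Mapping.keys q" by auto
    then show ?thesis using keys_add[of a b] p by blast
  qed
  then show ?case
    using p by (intro exI[of _ "p * q"]) (auto simp: poly_eval_mult)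
qed

text \<open>The one consequence of algebraic independence on which the later sections rely:
  nonvanishing at a single, freely chosen point \<open>y\<close> transfers to
  \<open>x\<close>.\<close>

definition generic_point :: "'i set \<Rightarrow> ('i \<Rightarrow> real) \<Rightarrow> bool" where
  "generic_point I x \<longleftrightarrow> (\<forall>F\<in>polyfun I. (\<exists>y. F y \<noteq> 0) \<longrightarrow> F x \<noteq> 0)"

lemma alg_independent_generic:
  assumes "alg_independent I x"
  shows "generic_point I x"
  unfolding generic_point_def
proof (intro ballI impI)
  fix F :: "('a \<Rightarrow> real) \<Rightarrow> real" assume "F \<in> polyfun I" "\<exists>y. F y \<noteq> 0"
  then show "F x \<noteq> 0"
    using polyfun_poly_eval[of F I] assms by (fastforce simp: alg_independent_def)
qed

lemma polyfun_reindex: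
  assumes "F \<in> polyfun J" "h ` J \<subseteq> I"
  shows "(\<lambda>x. F (x \<circ> h)) \<in> polyfun I"
  using assms(1)
proof induction
  case (var i)
  then show ?case using assms(2) polyfun.var[of "h i" I] by auto
qed (auto intro: polyfun.intros)

lemma polyfun_cong:
  assumes "F \<in> polyfun J" "\<And>i. i \<in> J \<Longrightarrow> x i = y i"
  shows "F x = F y"
  using assms by induction auto

text \<open>A point \<open>y\<close> where \<open>F\<close> is nonzero is moved to the larger index
  set along \<open>inv_into J h\<close>; by injectivity it restricts to \<open>y\<close> again on
  \<open>J\<close>, and \<open>F\<close> looks only at \<open>J\<close>.\<close>

lemma generic_point_reindex:
  assumes "generic_point I x" "inj_on h J" "h ` J \<subseteq> I"
  shows "generic_point J (x \<circ> h)"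
  unfolding generic_point_def
proof (intro ballI impI)
  fix F :: "('b \<Rightarrow> real) \<Rightarrow> real" assume F: "F \<in> polyfun J" and "\<exists>y. F y \<noteq> 0"
  then obtain y where y: "F y \<noteq> 0" by blast
  have "F ((y \<circ> inv_into J h) \<circ> h) = F y"
    by (rule polyfun_cong[OF F]) (simp add: assms(2))
  with y polyfun_reindex[OF F assms(3)] assms(1) show "F (x \<circ> h) \<noteq> 0"
    unfolding generic_point_def by metis
qed

subsection \<open>Existence of algebraically independent reals\<close>

text \<open>A finitely supported function is determined by its graph over the support, a finite
  subset of a countable product. Two applications make the rational polynomials countable.\<close>

lemma countable_poly_mapping:
  assumes "countable (UNIV :: 'a set)" "countable (UNIV :: 'b::zero set)"
  shows "countable (UNIV :: ('a \<Rightarrow>\<^sub>0 'b) set)"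
proof -
  let ?g = "\<lambda>p :: 'a \<Rightarrow>\<^sub>0 'b. (\<lambda>k. (k, Poly_Mapping.lookup p k)) ` Poly_Mapping.keys p"
  have "inj ?g"
  proof (rule injI, rule poly_mapping_eqI)
    fix p q k assume eq: "?g p = ?g q"
    have "(k, v) \<in> ?g p \<longleftrightarrow> v \<noteq> 0 \<and> Poly_Mapping.lookup p k = v" for p :: "'a \<Rightarrow>\<^sub>0 'b" and k v
      by (auto simp: in_keys_iff)
    with eq show "Poly_Mapping.lookup p k = Poly_Mapping.lookup q k"
      by (metis (mono_tags, lifting))
  qed
  have "countable (UNIV :: ('a \<times> 'b) set)"
    using countable_SIGMA[of "UNIV :: 'a set" "\<lambda>_. UNIV :: 'b set"] assms by simp
  then have "countable {A :: ('a \<times> 'b) set. finite A \<and> A \<subseteq> UNIV}"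
    by (intro countable_Collect_finite_subset)
  then have "countable (range ?g)"
    by (rule countable_subset[rotated]) auto
  then show ?thesis
    using \<open>inj ?g\<close> by (rule countable_image_inj_on)
qed

text \<open>Read in the variable \<open>i\<close> alone, \<open>p\<close> becomes the real
  polynomial \<open>q\<close>. Its coefficient at exponent \<open>d\<close> is the value at
  \<open>x\<close> of a nonzero rational polynomial \<open>r\<close> over \<open>I\<close>, so
  independence of \<open>x\<close> on \<open>I\<close> gives \<open>q\<close> a nonzero
  coefficient.\<close>

lemma finite_roots_of_variable:
  assumes indep: "alg_independent I x" and "i \<notin> I" and "p \<noteq> 0"
    and keys: "\<forall>m\<in>Poly_Mapping.keys p. Poly_Mapping.keys m \<subseteq> insert i I"
  shows "finite {t. poly_eval (x(i := t)) p = 0}"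
proof -
  let ?u = "Poly_Mapping.update i 0" and ?c = "Poly_Mapping.lookup p"
  define q where "q = (\<Sum>m\<in>Poly_Mapping.keys p.
    monom (of_rat (?c m) * monom_eval x (?u m)) (Poly_Mapping.lookup m i))"
  have eval: "poly q t = poly_eval (x(i := t)) p" for t
    by (simp add: q_def poly_sum poly_monom poly_eval_superset[of "Poly_Mapping.keys p"]
        monom_eval_update algebra_simps)
  obtain m0 where m0: "m0 \<in> Poly_Mapping.keys p"
    using \<open>p \<noteq> 0\<close> by fastforce
  define d where "d = Poly_Mapping.lookup m0 i"
  define M where "M = {m \<in> Poly_Mapping.keys p. Poly_Mapping.lookup m i = d}"
  define r where "r = (\<Sum>m\<in>M. Poly_Mapping.single (?u m) (?c m))"
  have "finite M" by (simp add: M_def)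
  \<comment> \<open>Among monomials with equal exponent of \<open>i\<close>, erasing
    \<open>i\<close> is injective, so the coefficient of \<open>m0\<close> is not cancelled in
    \<open>r\<close>.\<close>
  have inj: "m = m0" if "m \<in> M" "?u m = ?u m0" for m
  proof (rule poly_mapping_eqI)
    fix k
    have "Poly_Mapping.lookup (?u m) k = Poly_Mapping.lookup (?u m0) k"
      by (simp only: that(2))
    then show "Poly_Mapping.lookup m k = Poly_Mapping.lookup m0 k"
      using that(1) by (auto simp: lookup_update M_def d_def split: if_splits)
  qed
  have "Poly_Mapping.lookup r (?u m0) = (\<Sum>m\<in>M. if m = m0 then ?c m else 0)"
    unfolding r_def lookup_sum using inj
    by (intro sum.cong) (auto simp: lookup_single when_def)
  also have "\<dots> = ?c m0"
    using m0 \<open>finite M\<close> by (simp add: M_def d_def)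
  finally have "r \<noteq> 0" using m0 by (auto simp: in_keys_iff)
  have "Poly_Mapping.keys m \<subseteq> I" if "m \<in> Poly_Mapping.keys r" for m
  proof -
    have "Poly_Mapping.lookup r m \<noteq> 0" using that by (simp add: in_keys_iff)
    then have "\<exists>m'\<in>M. Poly_Mapping.lookup (Poly_Mapping.single (?u m') (?c m')) m \<noteq> 0"
      unfolding r_def lookup_sum by (meson sum.neutral)
    then obtain m' where "m' \<in> M" "?u m' = m"
      by (auto simp: lookup_single when_def split: if_splits)
    then show ?thesis using keys by (fastforce simp: keys_update M_def)
  qed
  with indep \<open>r \<noteq> 0\<close> have "poly_eval x r \<noteq> 0"
    unfolding alg_independent_def by blast
  moreover have "poly_eval x r = coeff q d"
    by (auto simp: r_def q_def poly_eval_sum poly_eval_single coeff_sum M_def sum.inter_filter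
        intro!: sum.cong)
  ultimately have "q \<noteq> 0" by auto
  then show ?thesis
    using poly_roots_finite[of q] by (simp add: eval)
qed

text \<open>Each of the countably many nonzero rational polynomials over \<open>insert i I\<close>
  forbids finitely many values of the new variable; the uncountable reals leave a value
  over.\<close>

lemma alg_independent_exists:
  fixes I :: "'i set"
  assumes "countable (UNIV :: 'i set)" "finite I"
  shows "\<exists>x. alg_independent I x"
  using assms(2)
proof induction
  case empty
  have "alg_independent {} (\<lambda>_ :: 'i. 0)"
    unfolding alg_independent_def
  proof (intro allI impI)
    fix p :: "('i \<Rightarrow>\<^sub>0 nat) \<Rightarrow>\<^sub>0 rat"
    assume *: "(\<forall>m\<in>Poly_Mapping.keys p. Poly_Mapping.keys m \<subseteq> {}) \<and> poly_eval (\<lambda>_. 0) p = 0"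
    then have sub: "Poly_Mapping.keys p \<subseteq> {0}" by auto
    with * have "Poly_Mapping.lookup p 0 = 0"
      by (simp add: poly_eval_superset[of "{0}"] monom_eval_def)
    with sub show "p = 0" by (metis in_keys_iff lookup_zero poly_mapping_eqI singletonD subsetD)
  qed
  then show ?case by blast
next
  case (insert i I)
  then obtain x where x: "alg_independent I x" by blast
  let ?P = "{p :: ('i \<Rightarrow>\<^sub>0 nat) \<Rightarrow>\<^sub>0 rat. p \<noteq> 0 \<and>
    (\<forall>m\<in>Poly_Mapping.keys p. Poly_Mapping.keys m \<subseteq> insert i I)}"
  have "countable (UNIV :: (('i \<Rightarrow>\<^sub>0 nat) \<Rightarrow>\<^sub>0 rat) set)"
    using assms(1) by (intro countable_poly_mapping) auto
  then have "countable ?P" by (rule countable_subset[rotated]) auto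
  then have "countable (\<Union>p\<in>?P. {t. poly_eval (x(i := t)) p = 0})"
    using finite_roots_of_variable[OF x insert.hyps(2)]
    by (intro countable_UN) (auto intro: countable_finite)
  then obtain t where t: "\<And>p. p \<in> ?P \<Longrightarrow> poly_eval (x(i := t)) p \<noteq> 0"
    using uncountable_UNIV_real by (metis (mono_tags, lifting) UNIV_eq_I UN_I mem_Collect_eq)
  then have "alg_independent (insert i I) (x(i := t))"
    unfolding alg_independent_def by blast
  then show ?case by blast
qed

lemma generic_matrix_exists: "\<exists>\<alpha>. generic_matrix n \<alpha>"
proof -
  obtain x where "alg_independent ({1..n} \<times> {1..n}) x"
    using alg_independent_exists[of "{1..n} \<times> {1..n}"] by auto
  moreover have "x = (\<lambda>(i, j). curry x i j)" by auto
  ultimately show ?thesis unfolding generic_matrix_def by metis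
qed

section \<open>Linear algebra of finitely indexed rows\<close>

text \<open>Coefficients belong to row indices, not to vectors, so two equal rows count as
  dependent; concrete small matrices become plain systems of equations for the simplifier.\<close>

definition indep_rows :: "'a set \<Rightarrow> 't set \<Rightarrow> ('a \<Rightarrow> 't \<Rightarrow> real) \<Rightarrow> bool" where
  "indep_rows A C F \<longleftrightarrow> (\<forall>c. (\<forall>t\<in>C. (\<Sum>s\<in>A. c s * F s t) = 0) \<longrightarrow> (\<forall>s\<in>A. c s = 0))"

lemma indep_rowsD:
  "indep_rows A C F \<Longrightarrow> (\<And>t. t \<in> C \<Longrightarrow> (\<Sum>s\<in>A. c s * F s t) = 0) \<Longrightarrow> s \<in> A \<Longrightarrow> c s = 0"
  unfolding indep_rows_def by blast

lemma indep_rows_subset: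
  assumes "indep_rows A C F" "finite A" "B \<subseteq> A"
  shows "indep_rows B C F"
  unfolding indep_rows_def
proof (intro allI impI ballI)
  fix c s assume c: "\<forall>t\<in>C. (\<Sum>s\<in>B. c s * F s t) = 0" and "s \<in> B"
  have "(\<Sum>s\<in>A. (if s \<in> B then c s else 0) * F s t) = (\<Sum>s\<in>B. c s * F s t)" for t
    using assms(2,3) by (intro sum.mono_neutral_cong_right) auto
  with c have "\<forall>s\<in>A. (if s \<in> B then c s else 0) = 0"
    using assms(1) unfolding indep_rows_def by presburger
  then have "(if s \<in> B then c s else 0) = 0" using \<open>s \<in> B\<close> assms(3) by blast
  then show "c s = 0" using \<open>s \<in> B\<close> by simp
qed

text \<open>Gaussian elimination by columns: a zero column is dropped, and otherwise a pivot row
  leaves together with its column, so the surplus of rows persists.\<close>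

lemma nontrivial_relation:
  fixes F :: "'a \<Rightarrow> 't \<Rightarrow> real"
  assumes "finite C" "finite A" "card C < card A"
  shows "\<exists>c. (\<exists>s\<in>A. c s \<noteq> 0) \<and> (\<forall>t\<in>C. (\<Sum>s\<in>A. c s * F s t) = 0)"
  using assms
proof (induction C arbitrary: A F rule: finite_induct)
  case empty
  then show ?case by (intro exI[of _ "\<lambda>_. 1"]) (auto simp: card_gt_0_iff)
next
  case (insert t C)
  show ?case
  proof (cases "\<forall>s\<in>A. F s t = 0")
    case True
    from insert obtain c where "\<exists>s\<in>A. c s \<noteq> 0" "\<forall>t\<in>C. (\<Sum>s\<in>A. c s * F s t) = 0"
      by (metis Suc_lessD card_insert_disjoint)
    with True show ?thesis by (intro exI[of _ c]) auto
  next
    case False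
    then obtain s0 where s0: "s0 \<in> A" "F s0 t \<noteq> 0" by blast
    let ?G = "\<lambda>s u. F s u - F s t / F s0 t * F s0 u"
    have "\<exists>c. (\<exists>s\<in>A - {s0}. c s \<noteq> 0) \<and> (\<forall>u\<in>C. (\<Sum>s\<in>A - {s0}. c s * ?G s u) = 0)"
      using insert.prems insert.hyps s0 by (intro insert.IH) auto
    then obtain c where c: "\<exists>s\<in>A - {s0}. c s \<noteq> 0"
      "\<And>u. u \<in> C \<Longrightarrow> (\<Sum>s\<in>A - {s0}. c s * ?G s u) = 0" by blast
    \<comment> \<open>The coefficient of the pivot row is chosen to make column \<open>t\<close>
      vanish.\<close>
    let ?c = "c(s0 := - (\<Sum>s\<in>A - {s0}. c s * F s t) / F s0 t)"
    have *: "(\<Sum>s\<in>A. ?c s * F s u) = (\<Sum>s\<in>A - {s0}. c s * ?G s u)" for u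
      using s0 insert.prems
      by (subst sum.remove[of _ s0])
         (auto simp: algebra_simps sum_subtractf sum_distrib_left sum_divide_distrib)
    have "(\<Sum>s\<in>A. ?c s * F s u) = 0" if "u \<in> insert t C" for u
      unfolding * using that c(2) s0 by auto
    with c(1) show ?thesis by (intro exI[of _ ?c]) auto
  qed
qed

text \<open>Vanishing of a combination only has to be tested on the columns \<open>C'\<close>, of which there are
  not more than rows.\<close>

lemma expressible_by_rows:
  fixes F :: "'a \<Rightarrow> 't \<Rightarrow> real"
  assumes "finite A" "finite C'" "card C' \<le> card A" and indep: "indep_rows A C F"
    and ext: "\<And>c d t. t \<in> C \<Longrightarrow> (\<And>u. u \<in> C' \<Longrightarrow> d * v u + (\<Sum>s\<in>A. c s * F s u) = 0) \<Longrightarrow>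
       d * v t + (\<Sum>s\<in>A. c s * F s t) = 0"
  shows "\<exists>c. \<forall>t\<in>C. v t = (\<Sum>s\<in>A. c s * F s t)"
proof -
  \<comment> \<open>\<open>None\<close> indexes the extra row \<open>v\<close>. There is now one row
    more than test columns, hence a relation; independence of \<open>A\<close> prevents the
    coefficient at \<open>None\<close> from being zero.\<close>
  let ?A = "insert None (Some ` A)" and ?F = "case_option v F"
  have card: "card ?A = Suc (card A)"
    using assms(1) by (simp add: card_image)
  then obtain c where c: "\<exists>s\<in>?A. c s \<noteq> 0" "\<And>t. t \<in> C' \<Longrightarrow> (\<Sum>s\<in>?A. c s * ?F s t) = 0"
    using nontrivial_relation[of C' ?A ?F] assms(1-3) by (auto simp del: bex_simps)
  have sum: "(\<Sum>s\<in>?A. c s * ?F s t) = c None * v t + (\<Sum>s\<in>A. c (Some s) * F s t)" for t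
    using assms(1) by (subst sum.insert) (auto simp: sum.reindex)
  have rel: "c None * v t + (\<Sum>s\<in>A. c (Some s) * F s t) = 0" if "t \<in> C" for t
  proof (rule ext[where c = "\<lambda>s. c (Some s)" and d = "c None" and t = t, OF that])
    fix u assume "u \<in> C'"
    from c(2)[OF this] show "c None * v u + (\<Sum>s\<in>A. c (Some s) * F s u) = 0"
      by (simp only: sum)
  qed
  have "c None \<noteq> 0"
  proof
    assume 0: "c None = 0"
    then have "c (Some s) = 0" if "s \<in> A" for s
      using that rel by (rule_tac indep_rowsD[OF indep, of "\<lambda>s. c (Some s)"]) auto
    with 0 c(1) show False by auto
  qed
  show ?thesis
  proof (intro exI ballI)
    fix t assume "t \<in> C"
    have "c None * v t = - (\<Sum>s\<in>A. c (Some s) * F s t)"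
      using rel[OF \<open>t \<in> C\<close>] by linarith
    then have "v t = - (\<Sum>s\<in>A. c (Some s) * F s t) / c None"
      using \<open>c None \<noteq> 0\<close> by (metis nonzero_mult_div_cancel_left)
    then show "v t = (\<Sum>s\<in>A. - c (Some s) / c None * F s t)"
      by (simp add: sum_negf sum_divide_distrib)
  qed
qed

text \<open>In the square case \<open>C\<close> itself serves as the set of test columns.\<close>

lemma indep_rows_spanning:
  fixes F :: "'a \<Rightarrow> 't \<Rightarrow> real"
  assumes "finite A" "finite C" "card C = card A" "indep_rows A C F"
  shows "\<exists>c. \<forall>t\<in>C. v t = (\<Sum>s\<in>A. c s * F s t)"
proof (rule expressible_by_rows[of A C C F])
  show "d * v t + (\<Sum>s\<in>A. c s * F s t) = 0"
    if "t \<in> C" "\<And>u. u \<in> C \<Longrightarrow> d * v u + (\<Sum>s\<in>A. c s * F s u) = 0" for c d t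
    by (rule that(2)[OF that(1)])
qed (use assms in simp_all)

text \<open>Fraction-free Gaussian elimination: all pivots are polynomial functions that do not vanish
  at \<open>y\<close>, hence not at the generic point \<open>x\<close>.\<close>

lemma indep_rows_generic:
  fixes F :: "'a \<Rightarrow> 't \<Rightarrow> ('i \<Rightarrow> real) \<Rightarrow> real"
  assumes "finite A" "generic_point I x"
    and "\<And>s t. s \<in> A \<Longrightarrow> t \<in> C \<Longrightarrow> F s t \<in> polyfun I"
    and "indep_rows A C (\<lambda>s t. F s t y)"
  shows "indep_rows A C (\<lambda>s t. F s t x)"
  using assms(1,3,4)
proof (induction A arbitrary: F rule: finite_induct)
  case empty
  then show ?case by (simp add: indep_rows_def)
next
  case (insert s0 A)
  have "\<exists>t0\<in>C. F s0 t0 y \<noteq> 0"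
  proof (rule ccontr)
    assume "\<not> ?thesis"
    then have "\<forall>t\<in>C. (\<Sum>s\<in>insert s0 A. (if s = s0 then 1 else 0) * F s t y) = 0"
      using insert.hyps by (auto intro!: sum.neutral)
    then have "\<forall>s\<in>insert s0 A. (if s = s0 then 1 else 0) = (0::real)"
      using insert.prems(2) unfolding indep_rows_def by presburger
    then show False by simp
  qed
  then obtain t0 where t0: "t0 \<in> C" "F s0 t0 y \<noteq> 0" by blast
  then have px: "F s0 t0 x \<noteq> 0"
    using assms(2) insert.prems(1)[of s0 t0] unfolding generic_point_def by blast
  let ?G = "\<lambda>s t z. F s0 t0 z * F s t z - F s t0 z * F s0 t z"
  have "indep_rows A C (\<lambda>s t. ?G s t y)"
    unfolding indep_rows_def
  proof (intro allI impI ballI)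
    fix c s assume c: "\<forall>t\<in>C. (\<Sum>s\<in>A. c s * ?G s t y) = 0" and "s \<in> A"
    \<comment> \<open>A relation among the eliminated rows lifts to the original rows. Without
      division, the lifted coefficients are multiplied by the pivot, which is nonzero at
      \<open>y\<close>.\<close>
    let ?c = "\<lambda>s. if s = s0 then - (\<Sum>s\<in>A. c s * F s t0 y) else c s * F s0 t0 y"
    have "(\<Sum>s\<in>insert s0 A. ?c s * F s t y) = (\<Sum>s\<in>A. c s * ?G s t y)" for t
    proof -
      have "(\<Sum>s\<in>A. ?c s * F s t y) = (\<Sum>s\<in>A. c s * F s0 t0 y * F s t y)"
        using insert.hyps by (intro sum.cong) auto
      then show ?thesis
        using insert.hyps by (simp add: algebra_simps sum_subtractf sum_distrib_left)
    qed
    with c have "\<forall>s\<in>insert s0 A. ?c s = 0"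
      using insert.prems(2) unfolding indep_rows_def by presburger
    then have "?c s = 0" using \<open>s \<in> A\<close> by blast
    then show "c s = 0" using t0 \<open>s \<in> A\<close> insert.hyps by (auto split: if_splits)
  qed
  moreover have "?G s t \<in> polyfun I" if "s \<in> A" "t \<in> C" for s t
    using that t0(1) by (intro polyfun_diff polyfun.mult insert.prems(1)) auto
  ultimately have IH: "indep_rows A C (\<lambda>s t. ?G s t x)"
    by (rule_tac insert.IH)
  show ?case
    unfolding indep_rows_def
  proof (intro allI impI)
    fix c assume "\<forall>t\<in>C. (\<Sum>s\<in>insert s0 A. c s * F s t x) = 0"
    then have c: "(\<Sum>s\<in>A. c s * F s t x) = - c s0 * F s0 t x" if "t \<in> C" for t
      using that insert.hyps by (simp add: eq_neg_iff_add_eq_0 add.commute)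
    have "(\<Sum>s\<in>A. c s * ?G s t x) = 0" if "t \<in> C" for t
    proof -
      have "(\<Sum>s\<in>A. c s * ?G s t x) = F s0 t0 x * (\<Sum>s\<in>A. c s * F s t x)
          - (\<Sum>s\<in>A. c s * F s t0 x) * F s0 t x"
        by (simp add: sum_distrib_left sum_distrib_right sum_subtractf algebra_simps)
      also have "\<dots> = 0" using c[OF that] c[OF t0(1)] by simp
      finally show ?thesis .
    qed
    then have cA: "c s = 0" if "s \<in> A" for s
      using that by (rule_tac indep_rowsD[OF IH, of c]) auto
    with c[OF t0(1)] px have "c s0 = 0" by simp
    with cA show "\<forall>s\<in>insert s0 A. c s = 0" by simp
  qed
qed

text \<open>Coefficients are indexed by \<open>A\<close> and not by the vectors, which matches
  \<open>indep_rows\<close> even when rows repeat.\<close>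

lemma span_image_explicit:
  fixes r :: "'a \<Rightarrow> 'b::real_vector"
  assumes "finite A" "v \<in> span (r ` A)"
  shows "\<exists>c. v = (\<Sum>s\<in>A. c s *\<^sub>R r s)"
  using assms(2)
proof (induction rule: span_induct_alt)
  case base
  then show ?case by (intro exI[of _ "\<lambda>_. 0"]) simp
next
  case (step c x y)
  then obtain s d where "s \<in> A" "x = r s" "y = (\<Sum>s\<in>A. d s *\<^sub>R r s)" by blast
  moreover have "(\<Sum>a\<in>A. (d a + (if a = s then c else 0)) *\<^sub>R r a)
      = (\<Sum>a\<in>A. d a *\<^sub>R r a) + (\<Sum>a\<in>A. if a = s then c *\<^sub>R r a else 0)"
    by (simp add: scaleR_add_left sum.distrib if_distrib[of "\<lambda>c. c *\<^sub>R _"] cong: if_cong)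
  ultimately show ?case
    using assms(1)
    by (intro exI[of _ "\<lambda>a. d a + (if a = s then c else 0)"]) (simp add: algebra_simps)
qed

section \<open>Shifting in terms of minors\<close>

lemma sum_fun_apply: "(\<Sum>a\<in>A. f a) x = (\<Sum>a\<in>A. f a x)" for f :: "'a \<Rightarrow> 'b \<Rightarrow> real"
  by (induction A rule: infinite_finite_induct) auto

lemma eq_sum_e_basis:
  assumes "\<And>T. \<not> T \<subseteq> {1..n} \<Longrightarrow> z T = 0"
  shows "z = (\<Sum>T\<in>Pow {1..n}. z T *\<^sub>R e_basis T)"
proof
  fix U
  have "(\<Sum>T\<in>Pow {1..n}. z T *\<^sub>R e_basis T) U = (\<Sum>T\<in>Pow {1..n}. if U = T then z T else 0)"
    unfolding sum_fun_apply by (intro sum.cong) (auto simp: scaleR_fun_def e_basis_def)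
  also have "\<dots> = z U"
    using assms[of U] by (subst sum.delta') auto
  finally show "z U = (\<Sum>T\<in>Pow {1..n}. z T *\<^sub>R e_basis T) U" by simp
qed

lemma exterior_algebra_iff: "z \<in> exterior_algebra n \<longleftrightarrow> (\<forall>T. \<not> T \<subseteq> {1..n} \<longrightarrow> z T = 0)"
proof
  assume "z \<in> exterior_algebra n"
  then show "\<forall>T. \<not> T \<subseteq> {1..n} \<longrightarrow> z T = 0"
    unfolding exterior_algebra_def
    by (induction rule: span_induct_alt) (auto simp: e_basis_def scaleR_fun_def split: if_splits)
next
  assume "\<forall>T. \<not> T \<subseteq> {1..n} \<longrightarrow> z T = 0"
  then have "z = (\<Sum>T\<in>Pow {1..n}. z T *\<^sub>R e_basis T)" by (intro eq_sum_e_basis) blast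
  also have "\<dots> \<in> exterior_algebra n"
    unfolding exterior_algebra_def by (intro span_sum span_scale span_base) auto
  finally show "z \<in> exterior_algebra n" .
qed

lemma wedge_mem_exterior_algebra:
  assumes "x \<in> exterior_algebra n" "y \<in> exterior_algebra n"
  shows "wedge x y \<in> exterior_algebra n"
  unfolding exterior_algebra_iff
proof (intro allI impI)
  fix U :: "nat set" assume "\<not> U \<subseteq> {1..n}"
  then have "\<not> S \<subseteq> {1..n} \<or> \<not> U - S \<subseteq> {1..n}" if "S \<subseteq> U" for S using that by blast
  with assms have "shuffle_sign S (U - S) * x S * y (U - S) = 0" if "S \<in> Pow U" for S
    using that unfolding exterior_algebra_iff by (metis PowD mult_eq_0_iff)
  then show "wedge x y U = 0" unfolding wedge_def by (rule sum.neutral[OF ballI])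
qed

lemma f_vec_apply: "f_vec n \<alpha> i {u} = (if u \<in> {1..n} then \<alpha> i u else 0)"
proof -
  have "f_vec n \<alpha> i {u} = (\<Sum>j\<in>{1..n}. if u = j then \<alpha> i j else 0)"
    unfolding f_vec_def sum_fun_apply
    by (intro sum.cong) (auto simp: scaleR_fun_def e_basis_def)
  then show ?thesis by simp
qed

lemma f_vec_apply_0: "\<nexists>u. S = {u} \<Longrightarrow> f_vec n \<alpha> i S = 0"
  by (auto simp add: f_vec_def sum_fun_apply scaleR_fun_def e_basis_def intro!: sum.neutral)

lemma f_wedge_mem_exterior_algebra: "f_wedge n \<alpha> S \<in> exterior_algebra n"
proof -
  have f: "f_vec n \<alpha> i \<in> exterior_algebra n" for i
    unfolding exterior_algebra_iff by (metis f_vec_apply f_vec_apply_0 empty_subsetI insert_subset)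
  have "foldr wedge (map (f_vec n \<alpha>) is) (e_basis {}) \<in> exterior_algebra n" for "is"
  proof (induction "is")
    case Nil
    then show ?case by (simp add: exterior_algebra_iff e_basis_def)
  next
    case (Cons i "is")
    then show ?case by (simp add: wedge_mem_exterior_algebra f)
  qed
  then show ?thesis by (simp add: f_wedge_def)
qed

lemma shuffle_sign_empty [simp]: "shuffle_sign S {} = 1" "shuffle_sign {} S = 1"
  by (simp_all add: shuffle_sign_def)

lemma wedge_e_basis_empty:
  assumes "finite T"
  shows "wedge (e_basis T) (e_basis {}) = e_basis T" "wedge (e_basis {}) (e_basis T) = e_basis T"
proof -
  show "wedge (e_basis T) (e_basis {}) = e_basis T"
  proof
    fix U :: "nat set"
    have "wedge (e_basis T) (e_basis {}) U = (\<Sum>S\<in>Pow U. if S = U then e_basis T U else 0)"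
      unfolding wedge_def by (intro sum.cong) (auto simp: e_basis_def)
    also have "\<dots> = e_basis T U"
      using assms by (cases "finite U") (auto simp: e_basis_def)
    finally show "wedge (e_basis T) (e_basis {}) U = e_basis T U" .
  qed
  show "wedge (e_basis {}) (e_basis T) = e_basis T"
  proof
    fix U :: "nat set"
    have "wedge (e_basis {}) (e_basis T) U = (\<Sum>S\<in>Pow U. if S = {} then e_basis T U else 0)"
      unfolding wedge_def by (intro sum.cong) (auto simp: e_basis_def)
    also have "\<dots> = e_basis T U"
      using assms by (cases "finite U") (auto simp: e_basis_def)
    finally show "wedge (e_basis {}) (e_basis T) U = e_basis T U" .
  qed
qed

text \<open>A product with a non-face \<open>e_basis T\<close> has nonzero coordinates only at sets
  containing \<open>T\<close>, and \<open>K\<close> is closed under subsets. Conversely,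
  \<open>e_basis T\<close> is a generator itself, multiplied by the unit on both sides.\<close>

lemma face_ideal_iff:
  assumes K: "\<And>S T. S \<in> K \<Longrightarrow> T \<subseteq> S \<Longrightarrow> T \<in> K" and z: "z \<in> exterior_algebra n"
  shows "z \<in> face_ideal n K \<longleftrightarrow> (\<forall>T\<in>K. z T = 0)"
proof
  assume "z \<in> face_ideal n K"
  then show "\<forall>T\<in>K. z T = 0"
    unfolding face_ideal_def
  proof (induction rule: span_induct_alt)
    case (step c g w)
    from step(1) obtain x y T where g: "g = wedge (wedge x (e_basis T)) y" and T: "T \<notin> K"
      by (auto simp only: mem_Collect_eq)
    have "wedge x (e_basis T) S = 0" if "S \<subseteq> U" "U \<in> K" for S U
      unfolding wedge_def
    proof (intro sum.neutral ballI)
      fix R assume "R \<in> Pow S"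
      have "S - R \<subseteq> U" using that(1) by blast
      then have "S - R \<noteq> T" using K[OF that(2)] T by blast
      then show "shuffle_sign R (S - R) * x R * e_basis T (S - R) = 0"
        by (simp add: e_basis_def)
    qed
    then have "g U = 0" if "U \<in> K" for U
      unfolding g wedge_def[of _ y] using that by (intro sum.neutral) auto
    with step show ?case by (simp add: scaleR_fun_def)
  qed simp
next
  assume 0: "\<forall>T\<in>K. z T = 0"
  have "z = (\<Sum>T\<in>Pow {1..n}. z T *\<^sub>R e_basis T)"
    using z unfolding exterior_algebra_iff by (intro eq_sum_e_basis) blast
  also have "\<dots> \<in> face_ideal n K"
  proof (unfold face_ideal_def, rule span_sum, fold face_ideal_def)
    fix T assume T: "T \<in> Pow {1..n}"
    show "z T *\<^sub>R e_basis T \<in> face_ideal n K"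
    proof (cases "T \<in> K")
      case True
      with 0 show ?thesis by (simp add: face_ideal_def span_zero)
    next
      case False
      have "finite T" using T finite_subset by auto
      then have "e_basis T = wedge (wedge (e_basis {}) (e_basis T)) (e_basis {})"
        by (simp add: wedge_e_basis_empty)
      moreover have "e_basis {} \<in> exterior_algebra n"
        by (simp add: exterior_algebra_iff e_basis_def)
      ultimately show ?thesis
        using False T unfolding face_ideal_def by (intro span_scale span_base) blast
    qed
  qed
  finally show "z \<in> face_ideal n K" .
qed

text \<open>Determinant by Laplace expansion along the first row, for lists of equal length; for
  other lengths the value has no meaning and uses are guarded by a length condition. Lists, rather
  than sets, leave the order of the columns free.\<close>

fun minor :: "('r \<Rightarrow> 'c \<Rightarrow> real) \<Rightarrow> 'r list \<Rightarrow> 'c list \<Rightarrow> real" where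
  "minor X [] vs = 1"
| "minor X (i # is) vs =
     (\<Sum>p<length vs. (- 1) ^ p * X i (vs ! p) * minor X is (take p vs @ drop (Suc p) vs))"

lemma minor_1 [simp]: "minor X [i] [a] = X i a"
  by simp

lemma minor_2 [simp]: "minor X [i, j] [a, b] = X i a * X j b - X i b * X j a"
  by (simp add: numeral_2_eq_2)

lemma minor_3 [simp]: "minor X [i, j, k] [a, b, c] =
    X i a * (X j b * X k c - X j c * X k b) - X i b * (X j a * X k c - X j c * X k a)
    + X i c * (X j a * X k b - X j b * X k a)"
  by (simp add: numeral_2_eq_2 numeral_3_eq_3)

declare minor.simps(2) [simp del]

lemma minor_map_cols: "minor X is (map l vs) = minor (\<lambda>i v. X i (l v)) is vs"
proof (induction "is" arbitrary: vs)
  case (Cons i "is")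
  show ?case
    unfolding minor.simps
  proof (rule sum.cong)
    fix p assume "p \<in> {..<length vs}"
    then show "(- 1) ^ p * X i (map l vs ! p) * minor X is (take p (map l vs) @ drop (Suc p) (map l vs))
      = (- 1) ^ p * X i (l (vs ! p)) * minor (\<lambda>i v. X i (l v)) is (take p vs @ drop (Suc p) vs)"
      using Cons[of "take p vs @ drop (Suc p) vs"] by (simp add: take_map drop_map)
  qed simp
qed simp

text \<open>Only singletons contribute to a product with a vector. In a sorted list exactly the
  \<open>p\<close> earlier entries are smaller than \<open>us ! p\<close>, whence the sign.\<close>

lemma wedge_f_vec:
  assumes us: "sorted_wrt (<) us" "set us \<subseteq> {1..n}"
  shows "wedge (f_vec n \<alpha> i) y (set us) =
    (\<Sum>p<length us. (- 1) ^ p * \<alpha> i (us ! p) * y (set (take p us @ drop (Suc p) us)))"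
proof -
  let ?U = "set us"
  let ?g = "\<lambda>S. shuffle_sign S (?U - S) * f_vec n \<alpha> i S * y (?U - S)"
  have dist: "distinct us" using us(1) strict_sorted_iff by blast
  have "wedge (f_vec n \<alpha> i) y ?U = sum ?g (Pow ?U)" by (simp add: wedge_def)
  also have "\<dots> = sum ?g ((\<lambda>u. {u}) ` ?U)"
  proof (rule sum.mono_neutral_right)
    show "\<forall>S\<in>Pow ?U - (\<lambda>u. {u}) ` ?U. ?g S = 0"
    proof
      fix S assume "S \<in> Pow ?U - (\<lambda>u. {u}) ` ?U"
      then have "\<nexists>u. S = {u}" by auto
      then show "?g S = 0" by (simp add: f_vec_apply_0)
    qed
  qed auto
  also have "\<dots> = (\<Sum>u\<in>?U. ?g {u})"
    by (subst sum.reindex) auto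
  also have "\<dots> = (\<Sum>p<length us. ?g {us ! p})"
    using bij_betw_nth[OF dist, of "{..<length us}" ?U]
    by (intro sum.reindex_bij_betw[symmetric]) auto
  also have "\<dots> = (\<Sum>p<length us. (- 1) ^ p * \<alpha> i (us ! p) * y (set (take p us @ drop (Suc p) us)))"
  proof (rule sum.cong)
    fix p assume "p \<in> {..<length us}"
    then have p: "p < length us" by simp
    have split: "us = take p us @ us ! p # drop (Suc p) us"
      using p by (rule id_take_nth_drop)
    have d: "distinct (take p us @ us ! p # drop (Suc p) us)"
      using split dist by simp
    have s: "sorted_wrt (<) (take p us @ us ! p # drop (Suc p) us)"
      using split us(1) by simp
    have U: "?U = insert (us ! p) (set (take p us) \<union> set (drop (Suc p) us))"
      using arg_cong[OF split, of set] by simp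
    have diff: "?U - {us ! p} = set (take p us @ drop (Suc p) us)"
      unfolding U using d by auto
    have "{(s, t). s \<in> {us ! p} \<and> t \<in> ?U - {us ! p} \<and> t < s}
        = Pair (us ! p) ` set (take p us)"
      unfolding diff using s by (auto simp: sorted_wrt_append)
    moreover have "card (set (take p us)) = p"
      using distinct_card[OF distinct_take[OF dist]] p by simp
    ultimately have "shuffle_sign {us ! p} (?U - {us ! p}) = (- 1) ^ p"
      unfolding shuffle_sign_def by (simp add: card_image inj_on_def)
    moreover have "us ! p \<in> {1..n}" using us(2) p nth_mem by blast
    ultimately show "?g {us ! p}
        = (- 1) ^ p * \<alpha> i (us ! p) * y (set (take p us @ drop (Suc p) us))"
      by (simp add: f_vec_apply diff)
  qed simp
  finally show ?thesis .
qed

text \<open>The previous expansion of a wedge with one more vector is the Laplace expansion of the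
  minor along its first row.\<close>

lemma foldr_wedge_eq_minor:
  assumes "sorted_wrt (<) us" "set us \<subseteq> {1..n}"
  shows "foldr wedge (map (f_vec n \<alpha>) is) (e_basis {}) (set us)
    = (if length us = length is then minor \<alpha> is us else 0)"
  using assms
proof (induction "is" arbitrary: us)
  case Nil
  then show ?case by (auto simp: e_basis_def)
next
  case (Cons i "is")
  have IH: "foldr wedge (map (f_vec n \<alpha>) is) (e_basis {}) (set (take p us @ drop (Suc p) us))
    = (if length us = Suc (length is) then minor \<alpha> is (take p us @ drop (Suc p) us) else 0)"
    if p: "p < length us" for p
  proof -
    have "sorted_wrt (<) (take p us @ us ! p # drop (Suc p) us)"
      using Cons.prems(1) id_take_nth_drop[OF p] by simp
    then have "sorted_wrt (<) (take p us @ drop (Suc p) us)"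
      by (simp add: sorted_wrt_append)
    moreover have "set (take p us @ drop (Suc p) us) \<subseteq> {1..n}"
      using Cons.prems(2) set_take_subset[of p us] set_drop_subset[of "Suc p" us] by auto
    ultimately show ?thesis
      using Cons.IH[of "take p us @ drop (Suc p) us"] p by auto
  qed
  have "foldr wedge (map (f_vec n \<alpha>) (i # is)) (e_basis {}) (set us)
    = (\<Sum>p<length us. (- 1) ^ p * \<alpha> i (us ! p) *
        foldr wedge (map (f_vec n \<alpha>) is) (e_basis {}) (set (take p us @ drop (Suc p) us)))"
    using wedge_f_vec[OF Cons.prems] by simp
  also have "\<dots> = (\<Sum>p<length us. (- 1) ^ p * \<alpha> i (us ! p) *
      (if length us = Suc (length is) then minor \<alpha> is (take p us @ drop (Suc p) us) else 0))"
    by (intro sum.cong refl) (simp only: IH lessThan_iff)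
  also have "\<dots> = (if length us = length (i # is) then minor \<alpha> (i # is) us else 0)"
    by (auto simp: minor.simps)
  finally show ?case .
qed

lemma f_wedge_eq_minor:
  assumes "finite S" "T \<subseteq> {1..n}"
  shows "f_wedge n \<alpha> S T = (if card T = card S
    then minor \<alpha> (sorted_list_of_set S) (sorted_list_of_set T) else 0)"
proof -
  have "finite T" using assms(2) finite_subset by auto
  then show ?thesis
    using foldr_wedge_eq_minor[of "sorted_list_of_set T" n \<alpha> "sorted_list_of_set S"] assms
    by (simp add: f_wedge_def)
qed

text \<open>\<open>\<sigma>\<close> is the sign of the sorting permutation. It is nonzero and common
  to all rows, so it rescales a column and leaves linear relations between rows intact.\<close>

lemma minor_sorted_cols:
  fixes vs :: "'c::linorder list"
  assumes "distinct vs" "length vs \<le> 3"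
  shows "\<exists>\<sigma>. \<sigma> \<noteq> 0 \<and> (\<forall>is. length is = length vs \<longrightarrow>
    minor X is vs = \<sigma> * minor X is (sorted_list_of_set (set vs)))"
proof -
  have *: ?thesis if "set ws = set vs" "sorted_wrt (<) ws" "\<sigma> \<noteq> 0"
    "\<And>is. length is = length vs \<Longrightarrow> minor X is vs = \<sigma> * minor X is ws" for ws \<sigma>
    using sorted_list_of_set.idem_if_sorted_distinct[of ws] that strict_sorted_iff by metis
  have len: "length vs = 0 \<or> length vs = 1 \<or> length vs = 2 \<or> length vs = 3"
    using assms(2) by presburger
  have l1: "\<exists>a. xs = [a]" if "length xs = 1" for xs :: "'d list"
    using that by (auto simp: length_Suc_conv)
  have l2: "\<exists>a b. xs = [a, b]" if "length xs = 2" for xs :: "'d list"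
    using that by (auto simp: length_Suc_conv numeral_2_eq_2)
  have l3: "\<exists>a b c. xs = [a, b, c]" if "length xs = 3" for xs :: "'d list"
    using that by (auto simp: length_Suc_conv numeral_3_eq_3)
  from len show ?thesis
  proof (elim disjE)
    assume "length vs = 0"
    then show ?thesis by (intro *[of "[]" 1]) auto
  next
    assume "length vs = 1"
    then show ?thesis using l1[of vs] by (intro *[of vs 1]) auto
  next
    assume len: "length vs = 2"
    then obtain a b where vs: "vs = [a, b]" using l2 by blast
    have sw: "minor X is [a, b] = - 1 * minor X is [b, a]" if "length is = 2" for "is"
      using l2[OF that] by auto
    from assms(1) vs consider "a < b" | "b < a" by fastforce
    then show ?thesis
    proof cases
      case 1
      then show ?thesis by (intro *[of vs 1]) (auto simp: vs)
    next
      case 2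
      show ?thesis
        by (rule *[of "[b, a]" "- 1"]) (use 2 sw in \<open>auto simp: vs numeral_2_eq_2\<close>)
    qed
  next
    assume len: "length vs = 3"
    then obtain a b c where vs: "vs = [a, b, c]" using l3 by blast
    have perm: "minor X is [a, b, c] = - 1 * minor X is [a, c, b]"
      "minor X is [a, b, c] = - 1 * minor X is [b, a, c]"
      "minor X is [a, b, c] = 1 * minor X is [b, c, a]"
      "minor X is [a, b, c] = 1 * minor X is [c, a, b]"
      "minor X is [a, b, c] = - 1 * minor X is [c, b, a]" if "length is = 3" for "is"
      using l3[OF that] by (auto simp: algebra_simps)
    have **: ?thesis if "set ws = {a, b, c}" "sorted_wrt (<) ws" "\<sigma> \<noteq> 0"
      "\<And>is. length is = 3 \<Longrightarrow> minor X is [a, b, c] = \<sigma> * minor X is ws" for ws \<sigma>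
      by (rule *[of ws \<sigma>]) (use that in \<open>auto simp: vs numeral_3_eq_3\<close>)
    from assms(1) vs consider "a < b \<and> b < c" | "a < c \<and> c < b" | "b < a \<and> a < c"
      | "b < c \<and> c < a" | "c < a \<and> a < b" | "c < b \<and> b < a"
      by (metis distinct_length_2_or_more linorder_less_linear)
    then show ?thesis
    proof cases
      case 1
      show ?thesis by (rule **[of "[a, b, c]" 1]) (use 1 in auto)
    next
      case 2
      show ?thesis by (rule **[OF _ _ _ perm(1)]) (use 2 in auto)
    next
      case 3
      show ?thesis by (rule **[OF _ _ _ perm(2)]) (use 3 in auto)
    next
      case 4
      show ?thesis by (rule **[OF _ _ _ perm(3)]) (use 4 in auto)
    next
      case 5
      show ?thesis by (rule **[OF _ _ _ perm(4)]) (use 5 in auto)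
    next
      case 6
      show ?thesis by (rule **[OF _ _ _ perm(5)]) (use 6 in auto)
    qed
  qed
qed

section \<open>The lexicographically greedy basis\<close>

lemma finite_abstract_simplicial_complex:
  assumes "abstract_simplicial_complex K"
  shows "finite (\<Union>K)" "vertices K = \<Union>K"
proof -
  show "finite (\<Union>K)"
    using assms by (auto simp: abstract_simplicial_complex_def)
  have "{v} \<in> K" if "S \<in> K" "v \<in> S" for v S
    using assms that unfolding abstract_simplicial_complex_def by (meson empty_subsetI insert_subset)
  then show "vertices K = \<Union>K" by (auto simp: vertices_def)
qed

text \<open>The first difference is easier to handle than \<open>Min\<close>: transitivity and
  comparisons of short lists become case distinctions.\<close>

lemma lex_less_iff:
  assumes "finite S" "finite T"
  shows "lex_less S T \<longleftrightarrow> card S = card T \<and> (\<exists>a\<in>S - T. \<forall>b<a. b \<in> S \<longleftrightarrow> b \<in> T)"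
proof (intro iffI conjI)
  assume L: "lex_less S T"
  then show "card S = card T" by (simp add: lex_less_def)
  let ?a = "Min (sym_diff S T)"
  have ne: "sym_diff S T \<noteq> {}" and a: "?a \<in> S" using L by (auto simp: lex_less_def)
  have "?a \<in> sym_diff S T" using ne assms by (intro Min_in) auto
  moreover have "b \<in> S \<longleftrightarrow> b \<in> T" if "b < ?a" for b
  proof (rule ccontr)
    assume "(b \<in> S) \<noteq> (b \<in> T)"
    then have "?a \<le> b" using assms by (intro Min_le) auto
    with that show False by simp
  qed
  ultimately show "\<exists>a\<in>S - T. \<forall>b<a. b \<in> S \<longleftrightarrow> b \<in> T" using a by blast
next
  assume *: "card S = card T \<and> (\<exists>a\<in>S - T. \<forall>b<a. b \<in> S \<longleftrightarrow> b \<in> T)"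
  then obtain a where a: "a \<in> S - T" "\<forall>b<a. b \<in> S \<longleftrightarrow> b \<in> T" by blast
  have "Min (sym_diff S T) = a"
  proof (rule Min_eqI)
    fix b assume "b \<in> sym_diff S T"
    with a(2) show "a \<le> b" by (meson DiffD1 DiffD2 UnE not_less)
  qed (use a assms in auto)
  with * a show "lex_less S T" by (auto simp: lex_less_def)
qed

lemma lex_less_trans:
  assumes "finite R" "finite S" "finite T" "lex_less R S" "lex_less S T"
  shows "lex_less R T"
proof -
  obtain a where a: "a \<in> R - S" "\<forall>b<a. b \<in> R \<longleftrightarrow> b \<in> S"
    using assms(1,2,4) by (auto simp: lex_less_iff)
  obtain a' where a': "a' \<in> S - T" "\<forall>b<a'. b \<in> S \<longleftrightarrow> b \<in> T"
    using assms(2,3,5) by (auto simp: lex_less_iff)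
  have "card R = card T" using assms by (simp add: lex_less_def)
  moreover have "min a a' \<in> R - T" "\<forall>b<min a a'. b \<in> R \<longleftrightarrow> b \<in> T"
    using a a' by (cases a a' rule: linorder_cases; auto simp: min_def)+
  ultimately show ?thesis unfolding lex_less_iff[OF assms(1,3)] by blast
qed

lemma lex_less_append:
  assumes "sorted_wrt (<) (ps @ i # is)" "sorted_wrt (<) (ps @ j # js)"
    and "length is = length js" "i < j"
  shows "lex_less (set (ps @ i # is)) (set (ps @ j # js))"
proof -
  have "card (set (ps @ i # is)) = card (set (ps @ j # js))"
    using assms(1-3) distinct_card[of "ps @ i # is"] distinct_card[of "ps @ j # js"]
    by (simp only: strict_sorted_iff length_append list.size)
  moreover have "i \<in> set (ps @ i # is) - set (ps @ j # js)"
    using assms by (auto simp: sorted_wrt_append)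
  moreover have "b \<in> set (ps @ i # is) \<longleftrightarrow> b \<in> set (ps @ j # js)" if "b < i" for b
    using that assms by (auto simp: sorted_wrt_append)
  ultimately show ?thesis by (subst lex_less_iff) (blast intro: finite_set)+
qed

text \<open>The faces of \<open>K\<close> are enumerated by the lists in \<open>C\<close>. Ordering the vertices of a face
  differently only changes the sign of a column of minors, so the order of the labels is
  immaterial.\<close>

lemma mem_shift_wrt_iff:
  fixes C :: "'v list set" and \<alpha> :: "nat \<Rightarrow> nat \<Rightarrow> real" and l :: "'v \<Rightarrow> nat"
  defines "row \<equiv> \<lambda>k is vs. if vs \<in> C \<and> length vs = k then minor (\<lambda>i v. \<alpha> i (l v)) is vs else 0"
  assumes K: "abstract_simplicial_complex K" "K = set ` C"
    and C: "\<And>vs. vs \<in> C \<Longrightarrow> distinct vs \<and> length vs \<le> 3"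
    and l: "inj_on l (vertices K)" "l ` vertices K \<subseteq> {1..n}"
    and S: "S \<subseteq> {1..n}"
  shows "S \<in> shift_wrt n \<alpha> ((`) l ` K) \<longleftrightarrow>
    row (card S) (sorted_list_of_set S) \<notin> span (row (card S) `
      {js. sorted_wrt (<) js \<and> set js \<subseteq> {1..n} \<and> length js = card S \<and> lex_less (set js) S})"
proof -
  define k where "k = card S"
  have vs: "set vs \<subseteq> vertices K" "l ` set vs \<in> (`) l ` K" "l ` set vs \<subseteq> {1..n}"
    "card (l ` set vs) = length vs" "distinct (map l vs)" if "vs \<in> C" for vs
  proof -
    show *: "set vs \<subseteq> vertices K" "l ` set vs \<in> (`) l ` K"
      using that K finite_abstract_simplicial_complex(2)[OF K(1)] by auto
    show "l ` set vs \<subseteq> {1..n}" using *(1) l(2) by blast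
    have inj: "inj_on l (set vs)" using l(1) *(1) inj_on_subset by blast
    then show "card (l ` set vs) = length vs" "distinct (map l vs)"
      using C[OF that] by (auto simp: card_image distinct_card distinct_map)
  qed
  have "\<forall>vs\<in>C. \<exists>\<sigma>. \<sigma> \<noteq> 0 \<and> (\<forall>is. length is = length vs \<longrightarrow>
      minor \<alpha> is (map l vs) = \<sigma> * minor \<alpha> is (sorted_list_of_set (l ` set vs)))"
    using minor_sorted_cols[of "map l vs" \<alpha> for vs] vs(5) C by simp
  then obtain \<sigma> where \<sigma>0: "\<And>vs. vs \<in> C \<Longrightarrow> \<sigma> vs \<noteq> 0"
    and \<sigma>: "\<And>vs is. vs \<in> C \<Longrightarrow> length is = length vs \<Longrightarrow>
      minor \<alpha> is (map l vs) = \<sigma> vs * minor \<alpha> is (sorted_list_of_set (l ` set vs))"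
    by (auto simp: bchoice_iff)
  \<comment> \<open>Restriction to the coordinates at faces of size \<open>k\<close>, corrected by
    the signs of the column orders.\<close>
  define \<Phi> :: "(nat set \<Rightarrow> real) \<Rightarrow> 'v list \<Rightarrow> real" where
    "\<Phi> z vs = (if vs \<in> C \<and> length vs = k then \<sigma> vs * z (l ` set vs) else 0)" for z vs
  have lin: "linear \<Phi>"
    by (rule linearI) (auto simp: \<Phi>_def scaleR_fun_def algebra_simps)
  have \<Phi>_row: "\<Phi> (f_wedge n \<alpha> S') = row k (sorted_list_of_set S')"
    if "S' \<subseteq> {1..n}" "card S' = k" for S'
  proof
    fix vs
    have "finite S'" using that(1) finite_subset by auto
    then show "\<Phi> (f_wedge n \<alpha> S') vs = row k (sorted_list_of_set S') vs"
      using that vs[of vs] \<sigma>[of vs "sorted_list_of_set S'"]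
      by (auto simp: \<Phi>_def row_def f_wedge_eq_minor minor_map_cols)
  qed
  let ?A = "{f_wedge n \<alpha> S' | S'. S' \<subseteq> {1..n} \<and> card S' = card S \<and> lex_less S' S}"
  \<comment> \<open>The homogeneous elements of degree \<open>k\<close>. On them the coordinates at
    faces of other sizes vanish, so \<open>\<Phi>\<close> misses nothing that the ideal
    sees.\<close>
  let ?W = "{z \<in> exterior_algebra n. \<forall>T. T \<subseteq> {1..n} \<and> card T \<noteq> k \<longrightarrow> z T = 0}"
  let ?L = "{js. sorted_wrt (<) js \<and> set js \<subseteq> {1..n} \<and> length js = k \<and> lex_less (set js) S}"
  have W_sub: "subspace ?W"
    unfolding subspace_def exterior_algebra_iff by (auto simp: scaleR_fun_def)
  have f_W: "f_wedge n \<alpha> S' \<in> ?W" if "S' \<subseteq> {1..n}" "card S' = k" for S'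
    using that finite_subset[OF that(1)]
    by (auto simp: f_wedge_mem_exterior_algebra f_wedge_eq_minor)
  have span_W: "span ?A \<subseteq> ?W"
    by (rule span_minimal[OF _ W_sub]) (use f_W k_def in blast)
  have K': "T \<in> (`) l ` K" if "R \<in> (`) l ` K" "T \<subseteq> R" for R T
  proof -
    from that obtain R' where "R' \<in> K" "R = l ` R'" by blast
    moreover from this that(2) obtain T' where "T' \<subseteq> R'" "T = l ` T'"
      by (meson subset_imageE)
    ultimately show ?thesis using K(1) unfolding abstract_simplicial_complex_def by blast
  qed
  \<comment> \<open>Within degree \<open>k\<close> the kernel of \<open>\<Phi>\<close> is the face
    ideal, so congruence turns into equality of images.\<close>
  have ideal: "f_wedge n \<alpha> S - g \<in> face_ideal n ((`) l ` K) \<longleftrightarrow> \<Phi> (f_wedge n \<alpha> S) = \<Phi> g"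
    if "g \<in> span ?A" for g
  proof -
    let ?z = "f_wedge n \<alpha> S - g"
    have z: "?z \<in> ?W"
      using that span_W f_W[OF S] k_def by (intro subspace_diff[OF W_sub]) auto
    then have "?z \<in> face_ideal n ((`) l ` K) \<longleftrightarrow> (\<forall>T\<in>(`) l ` K. ?z T = 0)"
      using K' by (intro face_ideal_iff) auto
    also have "\<dots> \<longleftrightarrow> (\<forall>vs\<in>C. ?z (l ` set vs) = 0)"
      unfolding K(2) by blast
    also have "\<dots> \<longleftrightarrow> (\<forall>vs. \<Phi> ?z vs = 0)"
    proof
      assume R: "\<forall>vs. \<Phi> ?z vs = 0"
      show "\<forall>vs\<in>C. ?z (l ` set vs) = 0"
      proof
        fix ws assume "ws \<in> C"
        show "?z (l ` set ws) = 0"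
        proof (cases "length ws = k")
          case True
          have "\<Phi> ?z ws = 0" using R by blast
          then show ?thesis using True \<open>ws \<in> C\<close> \<sigma>0[OF \<open>ws \<in> C\<close>] by (simp add: \<Phi>_def)
        next
          case False
          then have "card (l ` set ws) \<noteq> k" using vs(4)[OF \<open>ws \<in> C\<close>] by simp
          with z vs(3)[OF \<open>ws \<in> C\<close>] show ?thesis by (simp only: mem_Collect_eq simp_thms)
        qed
      qed
    qed (simp add: \<Phi>_def)
    also have "\<dots> \<longleftrightarrow> \<Phi> ?z = 0" by (auto simp: fun_eq_iff)
    also have "\<dots> \<longleftrightarrow> \<Phi> (f_wedge n \<alpha> S) = \<Phi> g"
      by (simp add: linear_diff[OF lin])
    finally show ?thesis .
  qed
  have "\<Phi> ` ?A = row k ` ?L"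
  proof (intro equalityI subsetI)
    fix x assume "x \<in> \<Phi> ` ?A"
    then obtain S' where S': "S' \<subseteq> {1..n}" "card S' = k" "lex_less S' S"
      "x = row k (sorted_list_of_set S')" using \<Phi>_row k_def by auto
    moreover have "finite S'" using S'(1) finite_subset by auto
    ultimately show "x \<in> row k ` ?L" by auto
  next
    fix x assume "x \<in> row k ` ?L"
    then obtain js where js: "sorted_wrt (<) js" "set js \<subseteq> {1..n}" "length js = k"
      "lex_less (set js) S" "x = row k js" by blast
    moreover have "sorted_list_of_set (set js) = js"
      using js(1) sorted_list_of_set.idem_if_sorted_distinct strict_sorted_iff by blast
    moreover have "card (set js) = k"
      using js(1,3) distinct_card strict_sorted_iff by blast
    ultimately have "x = \<Phi> (f_wedge n \<alpha> (set js))" using \<Phi>_row[of "set js"] by simp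
    with js \<open>card (set js) = k\<close> show "x \<in> \<Phi> ` ?A" unfolding k_def by blast
  qed
  moreover have "S \<notin> shift_wrt n \<alpha> ((`) l ` K) \<longleftrightarrow> \<Phi> (f_wedge n \<alpha> S) \<in> \<Phi> ` span ?A"
    using S ideal unfolding shift_wrt_def by auto
  moreover have "\<Phi> ` span ?A = span (\<Phi> ` ?A)"
    by (rule linear_span_image[OF lin, symmetric])
  ultimately show ?thesis
    using \<Phi>_row[OF S] k_def by auto
qed

text \<open>If the rows indexed by \<open>D\<close> are independent and every other row depends on smaller rows
  in \<open>D\<close>, then the greedy choice of a basis in lexicographic order selects exactly \<open>D\<close>.\<close>

lemma shift_wrt_eqI:
  fixes C :: "'v list set" and \<alpha> :: "nat \<Rightarrow> nat \<Rightarrow> real" and l :: "'v \<Rightarrow> nat"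
  defines "X \<equiv> \<lambda>i v. \<alpha> i (l v)"
  assumes K: "abstract_simplicial_complex K" "K = set ` C"
    and C: "\<And>vs. vs \<in> C \<Longrightarrow> distinct vs \<and> length vs \<le> 3"
    and l: "inj_on l (vertices K)" "l ` vertices K \<subseteq> {1..n}"
    and "finite D" and D: "\<And>is. is \<in> D \<Longrightarrow> sorted_wrt (<) is \<and> set is \<subseteq> {1..n}"
    and indep: "\<And>k. indep_rows {is \<in> D. length is = k} {vs \<in> C. length vs = k} (minor X)"
    and expr: "\<And>is. sorted_wrt (<) is \<Longrightarrow> set is \<subseteq> {1..n} \<Longrightarrow> is \<notin> D \<Longrightarrow>
      \<exists>c. \<forall>vs\<in>{vs \<in> C. length vs = length is}. minor X is vs =
        (\<Sum>js\<in>{js \<in> D. length js = length is \<and> lex_less (set js) (set is)}. c js * minor X js vs)"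
  shows "shift_wrt n \<alpha> ((`) l ` K) = set ` D"
proof -
  define row where
    "row k is vs = (if vs \<in> C \<and> length vs = k then minor X is vs else 0)" for k "is" vs
  have expr': "row (length is) is \<in> span (row (length is) `
      {js \<in> D. length js = length is \<and> lex_less (set js) (set is)})"
    if is_: "sorted_wrt (<) is" "set is \<subseteq> {1..n}" "is \<notin> D" for "is"
  proof -
    let ?J = "{js \<in> D. length js = length is \<and> lex_less (set js) (set is)}"
    obtain c where "\<forall>vs\<in>{vs \<in> C. length vs = length is}.
        minor X is vs = (\<Sum>js\<in>?J. c js * minor X js vs)"
      using expr[OF is_] by blast
    then have "row (length is) is = (\<Sum>js\<in>?J. c js *\<^sub>R row (length is) js)"
      by (auto simp: fun_eq_iff row_def sum_fun_apply scaleR_fun_def)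
    also have "\<dots> \<in> span (row (length is) ` ?J)"
      by (intro span_sum span_scale span_base) blast
    finally show ?thesis .
  qed
  have "S \<in> shift_wrt n \<alpha> ((`) l ` K) \<longleftrightarrow> S \<in> set ` D" if S: "S \<subseteq> {1..n}" for S
  proof -
    define "is" where "is = sorted_list_of_set S"
    have "finite S" using S finite_subset by auto
    then have is_: "set is = S" "sorted_wrt (<) is" "length is = card S"
      by (simp_all add: is_def)
    have eq: "sorted_list_of_set (set js) = js" if "sorted_wrt (<) js" for js :: "nat list"
      using that sorted_list_of_set.idem_if_sorted_distinct strict_sorted_iff by blast
    have S_D: "S \<in> set ` D \<longleftrightarrow> is \<in> D"
    proof
      assume "S \<in> set ` D"
      then obtain js where "js \<in> D" "S = set js" by blast
      then show "is \<in> D" using D[of js] eq[of js] by (simp add: is_def)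
    qed (use is_(1) in blast)
    let ?L = "{js. sorted_wrt (<) js \<and> set js \<subseteq> {1..n} \<and> length js = card S \<and> lex_less (set js) S}"
    let ?Dk = "{js \<in> D. length js = card S}"
    have iff: "S \<in> shift_wrt n \<alpha> ((`) l ` K) \<longleftrightarrow>
        row (card S) is \<notin> span (row (card S) ` ?L)"
      using mem_shift_wrt_iff[OF K C l S, of \<alpha>]
      unfolding is_def row_def[abs_def] X_def by simp
    have "row (card S) is \<in> span (row (card S) ` ?L)" if "is \<notin> D"
    proof -
      have "row (card S) is \<in> span (row (card S) `
          {js \<in> D. length js = card S \<and> lex_less (set js) S})"
        using expr'[of "is"] is_ S that by simp
      also have "\<dots> \<subseteq> span (row (card S) ` ?L)"
        using D by (intro span_mono image_mono) auto
      finally show ?thesis .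
    qed
    moreover have "row (card S) is \<notin> span (row (card S) ` ?L)" if "is \<in> D"
    proof
      assume "row (card S) is \<in> span (row (card S) ` ?L)"
      \<comment> \<open>A smaller row either lies in \<open>D\<close> or is a combination of still
        smaller rows in \<open>D\<close>; by transitivity none of these is the row of
        \<open>S\<close> itself.\<close>
      also have "span (row (card S) ` ?L) \<subseteq> span (row (card S) ` (?Dk - {is}))"
      proof (rule span_minimal)
        show "row (card S) ` ?L \<subseteq> span (row (card S) ` (?Dk - {is}))"
        proof (rule image_subsetI)
          fix js assume js: "js \<in> ?L"
          have ne: "js' \<noteq> is" if "lex_less (set js') S" for js'
            using that is_(1) by (auto simp: lex_less_def)
          show "row (card S) js \<in> span (row (card S) ` (?Dk - {is}))"
          proof (cases "js \<in> D")
            case True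
            then show ?thesis using js ne by (intro span_base imageI) auto
          next
            case False
            have "row (card S) js \<in> span (row (card S) `
                {js' \<in> D. length js' = card S \<and> lex_less (set js') (set js)})"
              using expr'[of js] js False by simp
            also have "\<dots> \<subseteq> span (row (card S) ` (?Dk - {is}))"
              using ne lex_less_trans[OF finite_set finite_set \<open>finite S\<close>, of _ js] js
              by (intro span_mono image_mono) auto
            finally show ?thesis .
          qed
        qed
      qed simp
      finally have in_span: "row (card S) is \<in> span (row (card S) ` (?Dk - {is}))" .
      have "finite (?Dk - {is})" using \<open>finite D\<close> by simp
      from span_image_explicit[OF this in_span]
      obtain c where c: "row (card S) is = (\<Sum>js\<in>?Dk - {is}. c js *\<^sub>R row (card S) js)"
        by (elim exE)
      have "(\<Sum>js\<in>?Dk. (c(is := - 1)) js * minor X js vs) = 0"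
        if "vs \<in> {vs \<in> C. length vs = card S}" for vs
      proof -
        have "minor X is vs = (\<Sum>js\<in>?Dk - {is}. c js * minor X js vs)"
          using fun_cong[OF c, of vs] that
          by (simp add: row_def sum_fun_apply scaleR_fun_def)
        moreover have "(\<Sum>js\<in>?Dk. (c(is := - 1)) js * minor X js vs)
            = - minor X is vs + (\<Sum>js\<in>?Dk - {is}. c js * minor X js vs)"
          using \<open>finite D\<close> \<open>is \<in> D\<close> is_(3)
          by (subst sum.remove[of _ "is"]) auto
        ultimately show ?thesis by simp
      qed
      then have "(c(is := - 1)) is = 0"
        using \<open>is \<in> D\<close> is_(3) by (rule_tac indep_rowsD[OF indep, of "card S" "c(is := - 1)"]) auto
      then show False by simp
    qed
    ultimately show ?thesis using iff S_D by blast
  qed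
  moreover have "S \<subseteq> {1..n}" if "S \<in> shift_wrt n \<alpha> ((`) l ` K) \<or> S \<in> set ` D" for S
    using that D by (auto simp: shift_wrt_def)
  ultimately show ?thesis by blast
qed

section \<open>Transfer of independence to every generic matrix and labelling\<close>

lemma polyfun_sum:
  assumes "\<And>a. a \<in> A \<Longrightarrow> F a \<in> polyfun I"
  shows "(\<lambda>x. \<Sum>a\<in>A. F a x) \<in> polyfun I"
  using assms
proof (induction A rule: infinite_finite_induct)
  case (insert a A)
  then show ?case using polyfun.add[of "F a" I "\<lambda>x. \<Sum>a\<in>A. F a x"] by simp
qed (use polyfun.const[of 0] in simp_all)

lemma polyfun_minor:
  assumes "set is \<subseteq> A" "set vs \<subseteq> B"
  shows "(\<lambda>x. minor (\<lambda>i v. x (i, v)) is vs) \<in> polyfun (A \<times> B)"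
  using assms
proof (induction "is" arbitrary: vs)
  case Nil
  then show ?case using polyfun.const[of 1] by simp
next
  case (Cons i "is")
  show ?case
    unfolding minor.simps
  proof (rule polyfun_sum)
    fix p assume "p \<in> {..<length vs}"
    then have p: "vs ! p \<in> B" using Cons.prems(2) nth_mem by fastforce
    have "set (take p vs @ drop (Suc p) vs) \<subseteq> B"
      using Cons.prems(2) set_take_subset[of p vs] set_drop_subset[of "Suc p" vs] by auto
    then have IH: "(\<lambda>x. minor (\<lambda>i v. x (i, v)) is (take p vs @ drop (Suc p) vs)) \<in> polyfun (A \<times> B)"
      using Cons.prems(1) by (intro Cons.IH) auto
    have sg: "(\<lambda>x. (- 1) ^ p) \<in> polyfun (A \<times> B)"
      using polyfun.const[of "(- 1) ^ p" "A \<times> B"] by simp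
    have var: "(\<lambda>x. x (i, vs ! p)) \<in> polyfun (A \<times> B)"
      using p Cons.prems(1) by (intro polyfun.var) auto
    show "(\<lambda>x. (- 1) ^ p * x (i, vs ! p) *
        minor (\<lambda>i v. x (i, v)) is (take p vs @ drop (Suc p) vs)) \<in> polyfun (A \<times> B)"
      by (rule polyfun.mult[OF polyfun.mult[OF sg var] IH])
  qed
qed

text \<open>An injective labelling selects a subfamily of the generic entries, so the columns may be
  indexed by the vertices themselves.\<close>

lemma generic_point_relabelled:
  assumes "generic_matrix n \<alpha>" "inj_on l V" "l ` V \<subseteq> {1..n}"
  shows "generic_point ({1..n} \<times> V) (\<lambda>(i, v). \<alpha> i (l v))"
proof -
  let ?h = "\<lambda>(i, v). (i, l v)"
  have "generic_point ({1..n} \<times> V) ((\<lambda>(i, j). \<alpha> i j) \<circ> ?h)"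
  proof (rule generic_point_reindex)
    show "generic_point ({1..n} \<times> {1..n}) (\<lambda>(i, j). \<alpha> i j)"
      using assms(1) by (simp add: generic_matrix_def alg_independent_generic)
    show "inj_on ?h ({1..n} \<times> V)" using assms(2) by (auto simp: inj_on_def)
  qed (use assms(3) in auto)
  then show ?thesis by (simp add: comp_def case_prod_unfold)
qed

text \<open>One certificate matrix \<open>Y\<close> settles all generic matrices and all
  labellings.\<close>

lemma indep_minors_generic:
  assumes "generic_matrix n \<alpha>" "inj_on l V" "l ` V \<subseteq> {1..n}" "finite D"
    and "\<And>is. is \<in> D \<Longrightarrow> set is \<subseteq> {1..n}" "\<And>vs. vs \<in> C \<Longrightarrow> set vs \<subseteq> V"
    and "indep_rows D C (minor Y)"
  shows "indep_rows D C (minor (\<lambda>i v. \<alpha> i (l v)))"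
proof -
  have "indep_rows D C (\<lambda>is vs. minor (\<lambda>i v. (\<lambda>(i, v). \<alpha> i (l v)) (i, v)) is vs)"
  proof (rule indep_rows_generic[where F = "\<lambda>is vs x. minor (\<lambda>i v. x (i, v)) is vs"])
    show "generic_point ({1..n} \<times> V) (\<lambda>(i, v). \<alpha> i (l v))"
      by (rule generic_point_relabelled[OF assms(1-3)])
    show "(\<lambda>x. minor (\<lambda>i v. x (i, v)) is vs) \<in> polyfun ({1..n} \<times> V)" if "is \<in> D" "vs \<in> C"
      for "is" vs using that assms(5,6) by (intro polyfun_minor)
    show "indep_rows D C (\<lambda>is vs. minor (\<lambda>i v. (case_prod Y) (i, v)) is vs)"
      using assms(7) by simp
  qed (rule assms(4))
  then show ?thesis by simp
qed

text \<open>Uniqueness for the \<open>THE\<close> comes from obtaining the same \<open>D\<close> for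
  every choice, existence from a generic matrix and some labelling.\<close>

lemma alg_shift_eqI:
  assumes "finite (vertices K)"
    and *: "\<And>n \<alpha> l. inj_on l (vertices K) \<Longrightarrow> l ` vertices K \<subseteq> {1..n} \<Longrightarrow>
      generic_matrix n \<alpha> \<Longrightarrow> shift_wrt n \<alpha> ((`) l ` K) = D"
  shows "alg_shift K = D"
  unfolding alg_shift_def
proof (rule the_equality)
  obtain f :: "'a \<Rightarrow> nat" and n where f: "f ` vertices K = {i. i < n}" "inj_on f (vertices K)"
    using finite_imp_inj_to_nat_seg[OF assms(1)] by blast
  obtain \<alpha> where \<alpha>: "generic_matrix n \<alpha>" using generic_matrix_exists by blast
  have "inj_on (Suc \<circ> f) (vertices K)" using f(2) by (auto simp: inj_on_def)
  moreover have "(Suc \<circ> f) ` vertices K \<subseteq> {1..n}" using f(1) by (auto simp: Suc_le_eq)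
  ultimately show "\<exists>n \<alpha> l. inj_on l (vertices K) \<and> l ` vertices K \<subseteq> {1..n} \<and>
      generic_matrix n \<alpha> \<and> D = shift_wrt n \<alpha> ((`) l ` K)"
    using *[OF _ _ \<alpha>] \<alpha> by metis
qed (use * in blast)

section \<open>Complexes of dimension at most two\<close>

text \<open>The dependence required by \<open>shift_wrt_eqI\<close>, for sets \<open>D\<close> and
  \<open>C\<close> that hold rows and columns of one fixed size.\<close>

definition lex_dependent ::
    "nat list set \<Rightarrow> 'v list set \<Rightarrow> (nat \<Rightarrow> 'v \<Rightarrow> real) \<Rightarrow> nat list \<Rightarrow> bool" where
  "lex_dependent D C X is \<longleftrightarrow> (\<exists>c. \<forall>vs\<in>C. minor X is vs =
     (\<Sum>js\<in>{js \<in> D. lex_less (set js) (set is)}. c js * minor X js vs))"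

lemma lex_dependentI:
  assumes "finite D" "J \<subseteq> D" "\<And>js. js \<in> J \<Longrightarrow> lex_less (set js) (set is)"
    and c: "\<And>vs. vs \<in> C \<Longrightarrow> minor X is vs = (\<Sum>js\<in>J. c js * minor X js vs)"
  shows "lex_dependent D C X is"
  unfolding lex_dependent_def
proof (intro exI ballI)
  fix vs assume "vs \<in> C"
  show "minor X is vs = (\<Sum>js\<in>{js \<in> D. lex_less (set js) (set is)}.
      (if js \<in> J then c js else 0) * minor X js vs)"
    unfolding c[OF \<open>vs \<in> C\<close>] using assms(1-3)
    by (intro sum.mono_neutral_cong_left) auto
qed

text \<open>The counting argument: \<open>D\<close> is a square independent block and hence spans
  all rows, and all of \<open>D\<close> precedes \<open>is\<close>.\<close>

lemma lex_dependent_last: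
  assumes "finite D" "finite C" "card C = card D" "indep_rows D C (minor X)"
    and "\<And>js. js \<in> D \<Longrightarrow> lex_less (set js) (set is)"
  shows "lex_dependent D C X is"
proof -
  obtain c where "\<forall>vs\<in>C. minor X is vs = (\<Sum>js\<in>D. c js * minor X js vs)"
    using indep_rows_spanning[OF assms(1-4)] by blast
  then show ?thesis using assms(1,5) by (intro lex_dependentI[where J = D and c = c]) auto
qed

lemma shift_wrt_dim2_eqI:
  fixes C\<^sub>1 C\<^sub>2 C\<^sub>3 :: "'v list set" and \<alpha> :: "nat \<Rightarrow> nat \<Rightarrow> real" and l :: "'v \<Rightarrow> nat"
  defines "X \<equiv> \<lambda>i v. \<alpha> i (l v)"
  assumes K: "abstract_simplicial_complex K" "K = set ` ({[]} \<union> C\<^sub>1 \<union> C\<^sub>2 \<union> C\<^sub>3)"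
    and dist: "\<And>vs. vs \<in> C\<^sub>1 \<union> C\<^sub>2 \<union> C\<^sub>3 \<Longrightarrow> distinct vs"
    and C: "\<And>vs. vs \<in> C\<^sub>1 \<Longrightarrow> length vs = 1" "\<And>vs. vs \<in> C\<^sub>2 \<Longrightarrow> length vs = 2"
      "\<And>vs. vs \<in> C\<^sub>3 \<Longrightarrow> length vs = 3"
    and l: "inj_on l (vertices K)" "l ` vertices K \<subseteq> {1..n}"
    and fin: "finite D\<^sub>1" "finite D\<^sub>2" "finite D\<^sub>3"
    and D: "\<And>is. is \<in> D\<^sub>1 \<Longrightarrow> length is = 1" "\<And>is. is \<in> D\<^sub>2 \<Longrightarrow> length is = 2"
      "\<And>is. is \<in> D\<^sub>3 \<Longrightarrow> length is = 3"
      "\<And>is. is \<in> D\<^sub>1 \<union> D\<^sub>2 \<union> D\<^sub>3 \<Longrightarrow> sorted_wrt (<) is \<and> set is \<subseteq> {1..n}"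
    and indep: "indep_rows D\<^sub>1 C\<^sub>1 (minor X)" "indep_rows D\<^sub>2 C\<^sub>2 (minor X)" "indep_rows D\<^sub>3 C\<^sub>3 (minor X)"
    and dep1: "\<And>i. 1 \<le> i \<Longrightarrow> i \<le> n \<Longrightarrow> [i] \<notin> D\<^sub>1 \<Longrightarrow> lex_dependent D\<^sub>1 C\<^sub>1 X [i]"
    and dep2: "\<And>i j. 1 \<le> i \<Longrightarrow> i < j \<Longrightarrow> j \<le> n \<Longrightarrow> [i, j] \<notin> D\<^sub>2 \<Longrightarrow> lex_dependent D\<^sub>2 C\<^sub>2 X [i, j]"
    and dep3: "\<And>i j k. 1 \<le> i \<Longrightarrow> i < j \<Longrightarrow> j < k \<Longrightarrow> k \<le> n \<Longrightarrow> [i, j, k] \<notin> D\<^sub>3 \<Longrightarrow>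
      lex_dependent D\<^sub>3 C\<^sub>3 X [i, j, k]"
  shows "shift_wrt n \<alpha> ((`) l ` K) = set ` ({[]} \<union> D\<^sub>1 \<union> D\<^sub>2 \<union> D\<^sub>3)"
proof -
  let ?C = "{[]} \<union> C\<^sub>1 \<union> C\<^sub>2 \<union> C\<^sub>3" and ?D = "{[]} \<union> D\<^sub>1 \<union> D\<^sub>2 \<union> D\<^sub>3"
  have selC: "{vs \<in> ?C. length vs = k} = (if k = 0 then {[]} else if k = 1 then C\<^sub>1
      else if k = 2 then C\<^sub>2 else if k = 3 then C\<^sub>3 else {})" for k
    using C by (auto split: if_splits)
  have selD: "{vs \<in> ?D. length vs = k} = (if k = 0 then {[]} else if k = 1 then D\<^sub>1
      else if k = 2 then D\<^sub>2 else if k = 3 then D\<^sub>3 else {})" for k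
    using D(1-3) by (auto split: if_splits)
  have selD': "{js \<in> ?D. length js = k \<and> P js} = {js \<in> {js \<in> ?D. length js = k}. P js}" for k P
    by blast
  show ?thesis
  proof (rule shift_wrt_eqI[OF K _ l])
    show "distinct vs \<and> length vs \<le> 3" if "vs \<in> ?C" for vs
      using that dist[of vs] C[of vs] by auto
    show "finite ?D" using fin by simp
    show "sorted_wrt (<) is \<and> set is \<subseteq> {1..n}" if "is \<in> ?D" for "is"
      using that D(4)[of "is"] by auto
    show "indep_rows {is \<in> ?D. length is = k} {vs \<in> ?C. length vs = k} (minor (\<lambda>i v. \<alpha> i (l v)))" for k
      unfolding selC selD using indep by (simp add: X_def) (simp add: indep_rows_def)
    fix "is" assume is_: "sorted_wrt (<) is" "set is \<subseteq> {1..n}" "is \<notin> ?D"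
    let ?G = "\<exists>c. \<forall>vs\<in>{vs \<in> ?C. length vs = length is}. minor (\<lambda>i v. \<alpha> i (l v)) is vs =
        (\<Sum>js\<in>{js \<in> ?D. length js = length is \<and> lex_less (set js) (set is)}.
          c js * minor (\<lambda>i v. \<alpha> i (l v)) js vs)"
    have ne: "is \<noteq> []" using is_(3) by auto
    consider i where "is = [i]" | i j where "is = [i, j]" | i j k where "is = [i, j, k]"
      | "length is > 3"
      using ne by (cases "is" rule: list.exhaust[case_names Nil Cons])
        (auto simp: neq_Nil_conv Suc_le_eq numeral_3_eq_3, metis length_greater_0_conv length_Cons neq_Nil_conv not_less_eq)
    then show ?G
    proof cases
      case 1
      then show ?thesis
        using dep1[of i] is_ unfolding selD' selC selD lex_dependent_def X_def by simp
    next
      case 2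
      then show ?thesis
        using dep2[of i j] is_ unfolding selD' selC selD lex_dependent_def X_def by simp
    next
      case 3
      then show ?thesis
        using dep3[of i j k] is_ unfolding selD' selC selD lex_dependent_def X_def by simp
    next
      \<comment> \<open>There are no faces with more than three vertices, so there is no column to
        test.\<close>
      case 4
      then show ?thesis unfolding selC by auto
    qed
  qed
qed

lemma lex_less_1: "i < i' \<Longrightarrow> lex_less {i} {i'}"
  using lex_less_append[of "[]" i "[]" i' "[]"] by simp

lemma lex_less_2:
  assumes "i < j" "i' < j'" "i < i' \<or> i = i' \<and> j < j'"
  shows "lex_less {i, j} {i', j'}"
  using assms lex_less_append[of "[]" i "[j]" i' "[j']"] lex_less_append[of "[i]" j "[]" j' "[]"]
  by auto

lemma lex_less_3:
  assumes "i < j" "j < k" "i' < j'" "j' < k'"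
    "i < i' \<or> i = i' \<and> j < j' \<or> i = i' \<and> j = j' \<and> k < k'"
  shows "lex_less {i, j, k} {i', j', k'}"
  using assms lex_less_append[of "[]" i "[j, k]" i' "[j', k']"]
    lex_less_append[of "[i]" j "[k]" j' "[k']"] lex_less_append[of "[i, j]" k "[]" k' "[]"]
  by auto

lemma minor_generic_nonzero:
  assumes "generic_matrix n \<alpha>" "inj_on l V" "l ` V \<subseteq> {1..n}" "set is \<subseteq> {1..n}" "set vs \<subseteq> V"
    and "minor Y is vs \<noteq> 0"
  shows "minor (\<lambda>i v. \<alpha> i (l v)) is vs \<noteq> 0"
proof -
  let ?F = "\<lambda>x. minor (\<lambda>i v. x (i, v)) is vs"
  have "\<exists>y. ?F y \<noteq> 0" using assms(6) by (intro exI[of _ "case_prod Y"]) simp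
  with bspec[OF generic_point_relabelled[OF assms(1-3), unfolded generic_point_def]
      polyfun_minor[OF assms(4,5)]]
  have "?F (\<lambda>(i, v). \<alpha> i (l v)) \<noteq> 0" by (rule mp)
  then show ?thesis by simp
qed

lemma card_le_of_labelling:
  assumes "inj_on l V" "l ` V \<subseteq> {1..n}"
  shows "card V \<le> n"
  using card_inj_on_le[OF assms] by simp

lemma indep_rows_vertices:
  assumes "distinct vs"
  shows "\<exists>Y. indep_rows ((\<lambda>i. [i]) ` {1..length vs}) ((\<lambda>v. [v]) ` set vs) (minor Y)"
proof -
  \<comment> \<open>The identity matrix once the vertices are numbered along \<open>vs\<close>; row
    numbers start at 1 and list positions at 0.\<close>
  let ?Y = "\<lambda>i v. if v = vs ! (i - 1) then 1 else 0 :: real"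
  have "c [i] = 0" if c: "\<forall>t\<in>(\<lambda>v. [v]) ` set vs.
      (\<Sum>s\<in>(\<lambda>i. [i]) ` {1..length vs}. c s * minor ?Y s t) = 0"
    and i: "i \<in> {1..length vs}" for c i
  proof -
    have "vs ! (i - 1) \<in> set vs" using i by (auto intro!: nth_mem)
    then have "0 = (\<Sum>s\<in>(\<lambda>i. [i]) ` {1..length vs}. c s * minor ?Y s [vs ! (i - 1)])"
      using c by auto
    also have "\<dots> = (\<Sum>j\<in>{1..length vs}. if j = i then c [j] else 0)"
    proof (subst sum.reindex)
      show "sum ((\<lambda>s. c s * minor ?Y s [vs ! (i - 1)]) \<circ> (\<lambda>i. [i])) {1..length vs}
        = (\<Sum>j\<in>{1..length vs}. if j = i then c [j] else 0)"
      proof (rule sum.cong)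
        fix j assume "j \<in> {1..length vs}"
        then have b: "1 \<le> i" "1 \<le> j" "i - 1 < length vs" "j - 1 < length vs" using i by auto
        have "vs ! (i - 1) = vs ! (j - 1) \<longleftrightarrow> i - 1 = j - 1"
          by (rule nth_eq_iff_index_eq[OF assms b(3,4)])
        also have "\<dots> \<longleftrightarrow> j = i" using b(1,2) by linarith
        finally have "vs ! (i - 1) = vs ! (j - 1) \<longleftrightarrow> j = i" .
        then show "((\<lambda>s. c s * minor ?Y s [vs ! (i - 1)]) \<circ> (\<lambda>i. [i])) j = (if j = i then c [j] else 0)"
          by simp
      qed simp
    qed (simp add: inj_on_def)
    also have "\<dots> = c [i]" using i by simp
    finally show ?thesis by simp
  qed
  then show ?thesis unfolding indep_rows_def by blast
qed

lemma lex_dependent_vertices: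
  assumes "finite V" "indep_rows ((\<lambda>i. [i]) ` {1..card V}) ((\<lambda>v. [v]) ` V) (minor X)"
    and "1 \<le> i" "[i] \<notin> (\<lambda>i. [i]) ` {1..card V}"
  shows "lex_dependent ((\<lambda>i. [i]) ` {1..card V}) ((\<lambda>v. [v]) ` V) X [i]"
proof -
  have "card V < i"
  proof (rule ccontr)
    assume "\<not> card V < i"
    then have "i \<in> {1..card V}" using assms(3) by simp
    then show False using assms(4) by blast
  qed
  then show ?thesis
    using assms(1,2) by (intro lex_dependent_last) (auto simp: card_image inj_on_def intro!: lex_less_1)
qed

text \<open>Leaves only finite certificates and dependences to check. \<open>Y\<^sub>2\<close> and
  \<open>Y\<^sub>3\<close> may differ, as each independence is transferred on its own. The
  dependences are asked for all \<open>i\<close>, \<open>j\<close>, \<open>k\<close>, because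
  \<open>n\<close> is arbitrary; \<open>dep3\<close> may also use that a minor which is nonzero for
  some matrix is nonzero for \<open>X\<close>.\<close>

lemma alg_shift_dim2_eqI:
  fixes C\<^sub>2 C\<^sub>3 :: "'v list set" and V :: "'v set"
  defines "C\<^sub>1 \<equiv> (\<lambda>v. [v]) ` V" and "D\<^sub>1 \<equiv> (\<lambda>i::nat. [i]) ` {1..card V}"
  assumes K: "abstract_simplicial_complex K" "K = set ` ({[]} \<union> C\<^sub>1 \<union> C\<^sub>2 \<union> C\<^sub>3)"
    and V: "finite V"
    and C: "\<And>vs. vs \<in> C\<^sub>2 \<union> C\<^sub>3 \<Longrightarrow> distinct vs \<and> set vs \<subseteq> V"
      "\<And>vs. vs \<in> C\<^sub>2 \<Longrightarrow> length vs = 2" "\<And>vs. vs \<in> C\<^sub>3 \<Longrightarrow> length vs = 3"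
    and fin: "finite D\<^sub>2" "finite D\<^sub>3"
    and D: "\<And>is. is \<in> D\<^sub>2 \<Longrightarrow> length is = 2" "\<And>is. is \<in> D\<^sub>3 \<Longrightarrow> length is = 3"
      "\<And>is. is \<in> D\<^sub>2 \<union> D\<^sub>3 \<Longrightarrow> sorted_wrt (<) is \<and> set is \<subseteq> {1..card V}"
    and indep: "indep_rows D\<^sub>2 C\<^sub>2 (minor Y\<^sub>2)" "indep_rows D\<^sub>3 C\<^sub>3 (minor Y\<^sub>3)"
    and dep2: "\<And>X i j. indep_rows D\<^sub>1 C\<^sub>1 (minor X) \<Longrightarrow> indep_rows D\<^sub>2 C\<^sub>2 (minor X) \<Longrightarrow>
      1 \<le> i \<Longrightarrow> i < j \<Longrightarrow> [i, j] \<notin> D\<^sub>2 \<Longrightarrow> lex_dependent D\<^sub>2 C\<^sub>2 X [i, j]"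
    and dep3: "\<And>X i j k. indep_rows D\<^sub>3 C\<^sub>3 (minor X) \<Longrightarrow>
      (\<And>Y is vs. set is \<subseteq> {1..card V} \<Longrightarrow> set vs \<subseteq> V \<Longrightarrow> minor Y is vs \<noteq> 0 \<Longrightarrow> minor X is vs \<noteq> 0) \<Longrightarrow>
      1 \<le> i \<Longrightarrow> i < j \<Longrightarrow> j < k \<Longrightarrow> [i, j, k] \<notin> D\<^sub>3 \<Longrightarrow> lex_dependent D\<^sub>3 C\<^sub>3 X [i, j, k]"
  shows "alg_shift K = set ` ({[]} \<union> D\<^sub>1 \<union> D\<^sub>2 \<union> D\<^sub>3)"
proof -
  have "\<Union>K = V" unfolding K(2) using C(1) by (auto simp: C\<^sub>1_def)
  then have VK: "vertices K = V" using finite_abstract_simplicial_complex(2)[OF K(1)] by simp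
  obtain ws where ws: "distinct ws" "set ws = V"
    using finite_distinct_list[OF V] by blast
  then have "length ws = card V" using distinct_card by force
  then obtain Y\<^sub>1 where Y\<^sub>1: "indep_rows D\<^sub>1 C\<^sub>1 (minor Y\<^sub>1)"
    using indep_rows_vertices[OF ws(1)] ws(2) unfolding C\<^sub>1_def D\<^sub>1_def by auto
  show ?thesis
  proof (rule alg_shift_eqI)
    show "finite (vertices K)" using V VK by simp
    fix n \<alpha> and l :: "'v \<Rightarrow> nat"
    assume l: "inj_on l (vertices K)" "l ` vertices K \<subseteq> {1..n}" and \<alpha>: "generic_matrix n \<alpha>"
    let ?X = "\<lambda>i v. \<alpha> i (l v)"
    have n: "card V \<le> n" using card_le_of_labelling[OF l] VK by simp
    have sub: "set is \<subseteq> {1..n}" if "set is \<subseteq> {1..card V}" for "is" :: "nat list"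
      using that n by fastforce
    have D1: "length is = 1 \<and> sorted_wrt (<) is \<and> set is \<subseteq> {1..card V}" if "is \<in> D\<^sub>1" for "is"
      using that by (auto simp: D\<^sub>1_def)
    have C1: "length vs = 1 \<and> distinct vs \<and> set vs \<subseteq> V" if "vs \<in> C\<^sub>1" for vs
      using that by (auto simp: C\<^sub>1_def)
    have fin1: "finite D\<^sub>1" by (simp add: D\<^sub>1_def)
    note gen = indep_minors_generic[OF \<alpha> l]
    have i1: "indep_rows D\<^sub>1 C\<^sub>1 (minor ?X)"
      by (rule gen[OF fin1 _ _ Y\<^sub>1]) (use D1 C1 sub VK in blast)+
    have i2: "indep_rows D\<^sub>2 C\<^sub>2 (minor ?X)"
      by (rule gen[OF fin(1) _ _ indep(1)]) (use C(1) D(3) sub VK in blast)+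
    have i3: "indep_rows D\<^sub>3 C\<^sub>3 (minor ?X)"
      by (rule gen[OF fin(2) _ _ indep(2)]) (use C(1) D(3) sub VK in blast)+
    have nz: "minor ?X is vs \<noteq> 0"
      if "set is \<subseteq> {1..card V}" "set vs \<subseteq> V" "minor Y is vs \<noteq> 0" for Y "is" vs
      by (rule minor_generic_nonzero[OF \<alpha> l sub[OF that(1)] _ that(3)]) (use that(2) VK in simp)
    show "shift_wrt n \<alpha> ((`) l ` K) = set ` ({[]} \<union> D\<^sub>1 \<union> D\<^sub>2 \<union> D\<^sub>3)"
    proof (rule shift_wrt_dim2_eqI[OF K _ _ _ _ l fin1 fin])
      show "lex_dependent D\<^sub>1 C\<^sub>1 ?X [i]" if "1 \<le> i" "[i] \<notin> D\<^sub>1" for i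
        using lex_dependent_vertices[OF V] that i1 unfolding C\<^sub>1_def D\<^sub>1_def by blast
      show "lex_dependent D\<^sub>2 C\<^sub>2 ?X [i, j]" if "1 \<le> i" "i < j" "[i, j] \<notin> D\<^sub>2" for i j
        by (rule dep2[OF i1 i2 that])
      show "lex_dependent D\<^sub>3 C\<^sub>3 ?X [i, j, k]" if "1 \<le> i" "i < j" "j < k" "[i, j, k] \<notin> D\<^sub>3" for i j k
        by (rule dep3[OF i3 nz that])
      show "distinct vs" if "vs \<in> C\<^sub>1 \<union> C\<^sub>2 \<union> C\<^sub>3" for vs
        using that C(1)[of vs] C1[of vs] by auto
      show "sorted_wrt (<) is \<and> set is \<subseteq> {1..n}" if "is \<in> D\<^sub>1 \<union> D\<^sub>2 \<union> D\<^sub>3" for "is"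
        using that D(3)[of "is"] D1[of "is"] sub[of "is"] by auto
    qed (use C C1 D D1 i1 i2 i3 in \<open>simp_all\<close>)
  qed
qed

section \<open>The counterexample\<close>

subsection \<open>Two points\<close>

lemma vertices_two_points: "vertices two_points = {1, 2}"
  by (auto simp: vertices_def two_points_def)

lemma two_points_complex: "abstract_simplicial_complex two_points"
  unfolding abstract_simplicial_complex_def two_points_def by (auto simp: subset_singleton_iff)

lemma two_points_shifted: "shifted two_points"
  unfolding shifted_def
proof (intro exI conjI)
  show "vertices two_points = {1..2}" unfolding vertices_two_points by auto
qed (auto simp: two_points_def)

text \<open>The existential claim shifts both factors of the join, while \<open>suspension\<close>
  joins with the unshifted two points; this identifies the two.\<close>

lemma alg_shift_two_points: "alg_shift two_points = two_points"
proof -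
  have "alg_shift two_points
      = set ` ({[]} \<union> (\<lambda>i. [i]) ` {1..card {1, 2 :: nat}} \<union> {} \<union> {})"
  proof (rule alg_shift_dim2_eqI[where C\<^sub>2 = "{}" and C\<^sub>3 = "{}"])
    show "two_points = set ` ({[]} \<union> (\<lambda>v. [v]) ` {1, 2} \<union> {} \<union> {})"
      by (auto simp: two_points_def)
    show "indep_rows {} {} (minor (\<lambda>_ _. 0))" "indep_rows {} {} (minor (\<lambda>_ _. 0))"
      by (simp_all add: indep_rows_def)
  qed (auto simp: two_points_complex lex_dependent_def)
  also have "\<dots> = two_points"
    by (auto simp: two_points_def image_Un image_image atLeastAtMost_insertL[symmetric])
  finally show ?thesis .
qed

subsection \<open>Two disjoint edges\<close>

lemma two_disjoint_edges_eq: "two_disjoint_edges = Pow {1, 2} \<union> Pow {3, 4}"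
  by (auto simp: two_disjoint_edges_def Pow_insert)

lemma two_disjoint_edges_complex: "abstract_simplicial_complex two_disjoint_edges"
  unfolding abstract_simplicial_complex_def two_disjoint_edges_eq
  by (auto dest: finite_subset)

lemma alg_shift_two_disjoint_edges:
  "alg_shift two_disjoint_edges = {{}, {1}, {2}, {3}, {4}, {1, 2}, {1, 3}}"
proof -
  \<comment> \<open>Row \<open>[1, 2]\<close> then meets only the edge 12 and row
    \<open>[1, 3]\<close> only the edge 34, each with minor -1.\<close>
  let ?Y = "\<lambda>(i :: nat) (v :: nat). if (i, v) \<in> {(1, 2), (1, 4), (2, 1), (3, 3)} then 1 else 0 :: real"
  have "alg_shift two_disjoint_edges
      = set ` ({[]} \<union> (\<lambda>i. [i]) ` {1..card {1, 2, 3, 4 :: nat}} \<union> {[1, 2], [1, 3]} \<union> {})"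
  proof (rule alg_shift_dim2_eqI[where C\<^sub>2 = "{[1, 2], [3, 4]}" and C\<^sub>3 = "{}"])
    show "two_disjoint_edges
        = set ` ({[]} \<union> (\<lambda>v. [v]) ` {1, 2, 3, 4} \<union> {[1, 2], [3, 4]} \<union> {})"
      by (auto simp: two_disjoint_edges_def)
    show "indep_rows {[1, 2], [1, 3]} {[1, 2], [3, 4]} (minor ?Y)"
      by (auto simp: indep_rows_def)
    show "indep_rows {} {} (minor (\<lambda>_ _. 0))"
      by (simp add: indep_rows_def)
    show "lex_dependent {[1, 2], [1, 3]} {[1, 2], [3, 4]} X [i, j]"
      if "indep_rows {[1, 2], [1, 3]} {[1, 2], [3, 4]} (minor X)" "1 \<le> i" "i < j"
        "[i, j] \<notin> {[1, 2], [1, 3]}" for X :: "nat \<Rightarrow> nat \<Rightarrow> real" and i j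
      using that by (intro lex_dependent_last) (auto intro!: lex_less_2)
  qed (auto simp: two_disjoint_edges_complex lex_dependent_def)
  also have "{1..card {1, 2, 3, 4 :: nat}} = {1, 2, 3, 4}" by auto
  finally show ?thesis by auto
qed

subsection \<open>The two suspensions\<close>

lemma simplicial_join_lists:
  "simplicial_join (set ` A) (set ` B) = set ` (\<Union>s\<in>A. (\<lambda>t. map Inl s @ map Inr t) ` B)"
proof -
  have *: "set (map Inl s @ map Inr t) = set s <+> set t" for s :: "'a list" and t :: "'b list"
    by (auto simp: Plus_def)
  have "set ` (\<Union>s\<in>A. (\<lambda>t. map Inl s @ map Inr t) ` B) = (\<Union>s\<in>A. (\<lambda>t. set s <+> set t) ` B)"
    unfolding image_UN image_image * ..
  also have "\<dots> = simplicial_join (set ` A) (set ` B)"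
    by (auto simp: simplicial_join_def)
  finally show ?thesis ..
qed

lemma simplicial_join_complex:
  assumes "abstract_simplicial_complex K" "abstract_simplicial_complex L"
  shows "abstract_simplicial_complex (simplicial_join K L)"
  unfolding abstract_simplicial_complex_def
proof (intro conjI ballI allI impI)
  have "simplicial_join K L = (\<lambda>(S, T). S <+> T) ` (K \<times> L)"
    by (auto simp: simplicial_join_def)
  then show "finite (simplicial_join K L)"
    using assms by (simp add: abstract_simplicial_complex_def)
  have "{} <+> {} = ({} :: ('a + 'b) set)" by auto
  moreover have "{} \<in> K" "{} \<in> L" using assms by (simp_all add: abstract_simplicial_complex_def)
  ultimately show "{} \<in> simplicial_join K L"
    unfolding simplicial_join_def by (metis (mono_tags, lifting) mem_Collect_eq)
next
  fix U assume "U \<in> simplicial_join K L"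
  then obtain S T where ST: "U = S <+> T" "S \<in> K" "T \<in> L"
    by (auto simp: simplicial_join_def)
  then show "finite U" using assms by (auto simp: abstract_simplicial_complex_def)
  fix W assume W: "W \<subseteq> U"
  have "W = (Inl -` W) <+> (Inr -` W)"
  proof (rule set_eqI)
    fix x show "x \<in> W \<longleftrightarrow> x \<in> (Inl -` W) <+> (Inr -` W)" by (cases x) auto
  qed
  moreover have "Inl -` W \<in> K" "Inr -` W \<in> L"
  proof -
    have "Inl -` W \<subseteq> S" "Inr -` W \<subseteq> T" using W ST(1) by auto
    with ST(2,3) assms show "Inl -` W \<in> K" "Inr -` W \<in> L"
      unfolding abstract_simplicial_complex_def by simp_all
  qed
  ultimately show "W \<in> simplicial_join K L"
    unfolding simplicial_join_def by (metis (mono_tags, lifting) mem_Collect_eq)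
qed

definition susp_vertices :: "(nat + nat) set" where
  "susp_vertices = {Inl 1, Inl 2, Inl 3, Inl 4, Inr 1, Inr 2}"

text \<open>\<open>p\<close> and \<open>q\<close> span the second base edge: 3 and 4 for the two
  disjoint edges, 1 and 3 for their shifting.\<close>

definition susp_edges :: "nat \<Rightarrow> nat \<Rightarrow> (nat + nat) list set" where
  "susp_edges p q = {[Inl 1, Inl 2], [Inl p, Inl q], [Inl 1, Inr 1], [Inl 1, Inr 2], [Inl 2, Inr 1],
     [Inl 2, Inr 2], [Inl 3, Inr 1], [Inl 3, Inr 2], [Inl 4, Inr 1], [Inl 4, Inr 2]}"

definition susp_triangles :: "nat \<Rightarrow> nat \<Rightarrow> (nat + nat) list set" where
  "susp_triangles p q = {[Inl 1, Inl 2, Inr 1], [Inl 1, Inl 2, Inr 2],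
     [Inl p, Inl q, Inr 1], [Inl p, Inl q, Inr 2]}"

text \<open>The ten lexicographically first pairs in \<open>{1..6}\<close>, one for each edge of
  either suspension.\<close>

definition shifted_edges :: "nat list set" where
  "shifted_edges = {[1, 2], [1, 3], [1, 4], [1, 5], [1, 6], [2, 3], [2, 4], [2, 5], [2, 6], [3, 4]}"

lemma card_susp_vertices: "card susp_vertices = 6"
  by (simp add: susp_vertices_def)

lemma suspension_lists:
  assumes "K = set ` {[], [1], [2], [3], [4], [1, 2], [p, q]}"
  shows "suspension K =
    set ` ({[]} \<union> (\<lambda>v. [v]) ` susp_vertices \<union> susp_edges p q \<union> susp_triangles p q)"
proof -
  have tp: "two_points = set ` {[], [1], [2]}" by (auto simp: two_points_def)
  have "suspension K = set ` (\<Union>s\<in>{[], [1], [2], [3], [4], [1, 2], [p, q]}.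
      (\<lambda>t. map Inl s @ map Inr t) ` {[], [1], [2]})"
    unfolding suspension_def assms tp by (rule simplicial_join_lists)
  also have "(\<Union>s\<in>{[], [1], [2], [3], [4], [1, 2], [p, q]}.
      (\<lambda>t. map Inl s @ map Inr t) ` {[], [1], [2 :: nat]})
    = {[]} \<union> (\<lambda>v. [v]) ` susp_vertices \<union> susp_edges p q \<union> susp_triangles p q"
    unfolding susp_vertices_def susp_edges_def susp_triangles_def
    by (intro equalityI) simp_all
  finally show ?thesis .
qed

text \<open>On the vertices, the row of \<open>j > 6\<close> is a combination of the rows of \<open>1, \<dots>, 6\<close>; wedging it
  with the row of \<open>i\<close> shows that \<open>{i, j}\<close> depends on the edges \<open>{i, h}\<close> with \<open>h \<le> 6\<close>.\<close>

lemma lex_dependent_shifted_edges: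
  assumes C: "finite C" "card C = 10" "\<And>vs. vs \<in> C \<Longrightarrow> \<exists>a\<in>susp_vertices. \<exists>b\<in>susp_vertices. vs = [a, b]"
    and indep1: "indep_rows ((\<lambda>i. [i]) ` {1..card susp_vertices}) ((\<lambda>v. [v]) ` susp_vertices) (minor X)"
    and indep2: "indep_rows shifted_edges C (minor X)"
    and ij: "1 \<le> i" "i < j" "[i, j] \<notin> shifted_edges"
  shows "lex_dependent shifted_edges C X [i, j]"
proof -
  have fin: "finite shifted_edges" by (simp add: shifted_edges_def)
  have "\<exists>c. \<forall>t\<in>(\<lambda>v. [v]) ` susp_vertices. minor X [j] t
      = (\<Sum>s\<in>(\<lambda>i. [i]) ` {1..card susp_vertices}. c s * minor X s t)"
    by (rule indep_rows_spanning[OF _ _ _ indep1])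
       (simp_all add: susp_vertices_def card_image inj_on_def)
  then obtain c where "\<forall>t\<in>(\<lambda>v. [v]) ` susp_vertices. minor X [j] t
      = (\<Sum>s\<in>(\<lambda>i. [i]) ` {1..card susp_vertices}. c s * minor X s t)" by (elim exE)
  moreover have "{1..card susp_vertices} = {1, 2, 3, 4, 5, 6}"
    unfolding card_susp_vertices by auto
  ultimately have Xj: "X j v = c [1] * X 1 v + c [2] * X 2 v + c [3] * X 3 v
      + c [4] * X 4 v + c [5] * X 5 v + c [6] * X 6 v" if "v \<in> susp_vertices" for v
    using that by simp
  have "i = 1 \<or> i = 2 \<or> i = 3 \<or> i > 3" using ij(1) by arith
  moreover have "j > 6" if "i = 1"
  proof -
    have "j \<noteq> 2 \<and> j \<noteq> 3 \<and> j \<noteq> 4 \<and> j \<noteq> 5 \<and> j \<noteq> 6"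
      using ij(3) unfolding that shifted_edges_def by simp
    then show ?thesis using ij(2) that by arith
  qed
  moreover have "j > 6" if "i = 2"
  proof -
    have "j \<noteq> 3 \<and> j \<noteq> 4 \<and> j \<noteq> 5 \<and> j \<noteq> 6"
      using ij(3) unfolding that shifted_edges_def by simp
    then show ?thesis using ij(2) that by arith
  qed
  moreover have "j > 4" if "i = 3"
  proof -
    have "j \<noteq> 4" using ij(3) unfolding that shifted_edges_def by simp
    then show ?thesis using ij(2) that by arith
  qed
  \<comment> \<open>Only in the third case do all ten rows come before \<open>[i, j]\<close>. A pair
    with \<open>i\<close> equal to 1 or 2 and \<open>j > 6\<close> precedes some of them, so
    counting does not apply.\<close>
  ultimately consider "i = 1" "j > 6" | "i = 2" "j > 6" | "i > 3 \<or> i = 3 \<and> j > 4" by blast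
  then show ?thesis
  proof cases
    case 1
    let ?J = "{[1, 2], [1, 3], [1, 4], [1, 5], [1, 6]} :: nat list set"
    show ?thesis
    proof (rule lex_dependentI[OF fin, where J = ?J and c = "\<lambda>js. c [js ! 1]"])
      fix vs assume "vs \<in> C"
      then obtain a b where ab: "a \<in> susp_vertices" "b \<in> susp_vertices" "vs = [a, b]" using C(3) by blast
      show "minor X [i, j] vs = (\<Sum>js\<in>?J. c [js ! 1] * minor X js vs)"
        unfolding ab(3) by (simp add: 1(1) Xj[OF ab(1)] Xj[OF ab(2)] algebra_simps)
    qed (use 1 in \<open>auto simp: shifted_edges_def intro!: lex_less_2\<close>)
  next
    case 2
    let ?J = "{[1, 2], [2, 3], [2, 4], [2, 5], [2, 6]} :: nat list set"
    \<comment> \<open>Wedging row 2 with row 1 gives the negative of the row \<open>[1, 2]\<close>;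
      the term of row 2 itself vanishes.\<close>
    let ?c = "\<lambda>js. if js = [1, 2] then - c [1] else c [js ! 1]"
    show ?thesis
    proof (rule lex_dependentI[OF fin, where J = ?J and c = ?c])
      fix vs assume "vs \<in> C"
      then obtain a b where ab: "a \<in> susp_vertices" "b \<in> susp_vertices" "vs = [a, b]" using C(3) by blast
      show "minor X [i, j] vs = (\<Sum>js\<in>?J. ?c js * minor X js vs)"
        unfolding ab(3) by (simp add: 2(1) Xj[OF ab(1)] Xj[OF ab(2)] algebra_simps)
    qed (use 2 in \<open>auto simp: shifted_edges_def intro!: lex_less_2\<close>)
  next
    case 3
    show ?thesis
    proof (rule lex_dependent_last[OF fin C(1) _ indep2])
      show "card C = card shifted_edges" using C(2) by (simp add: shifted_edges_def)
      show "lex_less (set js) (set [i, j])" if "js \<in> shifted_edges" for js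
        using that 3 ij(2) by (auto simp: shifted_edges_def intro!: lex_less_2)
    qed
  qed
qed

section \<open>Certificates and dependences for the two suspensions\<close>

lemma susp_edges_props:
  assumes "(p, q) \<in> {(3, 4), (1, 3)}"
  shows "finite (susp_edges p q)" "card (susp_edges p q) = 10"
    "finite (susp_triangles p q)" "card (susp_triangles p q) = 4"
    "\<forall>vs\<in>susp_edges p q. \<exists>a\<in>susp_vertices. \<exists>b\<in>susp_vertices. vs = [a, b]"
    "\<forall>vs\<in>susp_edges p q \<union> susp_triangles p q. distinct vs \<and> set vs \<subseteq> susp_vertices"
    "\<forall>vs\<in>susp_edges p q. length vs = 2"
    "\<forall>vs\<in>susp_triangles p q. length vs = 3"
proof -
  from assms consider "p = 3" "q = 4" | "p = 1" "q = 3" by auto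
  note pq = this
  show "finite (susp_edges p q)" "finite (susp_triangles p q)"
    by (simp_all add: susp_edges_def susp_triangles_def)
  show "card (susp_edges p q) = 10" "card (susp_triangles p q) = 4"
    by (rule pq; simp add: susp_edges_def susp_triangles_def)+
  show "\<forall>vs\<in>susp_edges p q. \<exists>a\<in>susp_vertices. \<exists>b\<in>susp_vertices. vs = [a, b]"
    "\<forall>vs\<in>susp_edges p q \<union> susp_triangles p q. distinct vs \<and> set vs \<subseteq> susp_vertices"
    by (rule pq; simp add: susp_edges_def susp_triangles_def susp_vertices_def)+
  show "\<forall>vs\<in>susp_edges p q. length vs = 2" "\<forall>vs\<in>susp_triangles p q. length vs = 3"
    by (simp_all add: susp_edges_def susp_triangles_def)
qed

text \<open>For this matrix every pair other than \<open>[1, 2]\<close> yields, up to sign, a single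
  edge, all of them distinct, and only \<open>[1, 2]\<close> meets the edge of \<open>Inl 1\<close>
  and \<open>Inl 2\<close>: a triangular system.\<close>

lemma indep_shifted_edges_34:
  "indep_rows shifted_edges (susp_edges 3 4)
     (minor (\<lambda>i v. if (i, v) \<in> {(1, Inl 1), (1, Inr 1), (2, Inl 2), (2, Inr 2), (3, Inl 4),
        (4, Inl 3), (5, Inr 2), (6, Inr 1)} then 1 else 0))"
  unfolding indep_rows_def shifted_edges_def susp_edges_def
  by (intro allI impI) simp

text \<open>Again triangular: all rows but \<open>[1, 2]\<close> and \<open>[2, 3]\<close> are
  single edges up to sign, and these two alone meet the base edges 12 and 13 respectively.\<close>

lemma indep_shifted_edges_13:
  "indep_rows shifted_edges (susp_edges 1 3)
     (minor (\<lambda>i v. if (i, v) \<in> {(1, Inl 2), (1, Inr 2), (2, Inl 1), (2, Inr 1), (3, Inl 3),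
        (4, Inr 1), (5, Inl 4), (6, Inr 2)} then 1 else 0))"
  unfolding indep_rows_def shifted_edges_def susp_edges_def
  by (intro allI impI) simp

text \<open>The minors form a signed permutation matrix: the rows ending in 3, 4, 5, 6 meet only
  \<open>[Inl 3, Inl 4, Inr 2]\<close>, \<open>[Inl 1, Inl 2, Inr 1]\<close>,
  \<open>[Inl 1, Inl 2, Inr 2]\<close> and \<open>[Inl 3, Inl 4, Inr 1]\<close>, in this
  order.\<close>

lemma indep_triangles_34:
  "indep_rows {[1, 2, 3 :: nat], [1, 2, 4], [1, 2, 5], [1, 2, 6]} (susp_triangles 3 4)
     (minor (\<lambda>i v. if (i, v) \<in> {(1, Inl 1), (1, Inl 3), (1, Inl 4), (1, Inr 2),
        (2, Inl 2), (2, Inl 3), (2, Inr 1), (3, Inl 1), (3, Inr 2), (4, Inl 2),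
        (5, Inl 3), (5, Inl 4), (5, Inr 2), (6, Inl 1), (6, Inl 4), (6, Inr 2)} then 1 else 0))"
  unfolding indep_rows_def susp_triangles_def
  by (intro allI impI) simp

text \<open>A signed permutation matrix once more. \<open>[1, 3, 4]\<close> supplies the column
  \<open>[Inl 1, Inl 2, Inr 2]\<close>, which the three rows with 1 and 2 leave out here.\<close>

lemma indep_triangles_13:
  "indep_rows {[1, 2, 3 :: nat], [1, 2, 4], [1, 2, 5], [1, 3, 4]} (susp_triangles 1 3)
     (minor (\<lambda>i v. if (i, v) \<in> {(1, Inl 1), (2, Inl 3), (2, Inr 1), (3, Inr 2),
        (4, Inl 2), (5, Inr 1)} then 1 else 0))"
  unfolding indep_rows_def susp_triangles_def
  by (intro allI impI) simp

text \<open>By a Pluecker relation, the four columns of the rows \<open>{1, 2, j}\<close> satisfy one linear relation,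
  so these rows span a space of dimension three.\<close>

lemma lex_dependent_triangles_13:
  fixes X :: "nat \<Rightarrow> nat + nat \<Rightarrow> real"
  defines "D \<equiv> {[1, 2, 3], [1, 2, 4], [1, 2, 5], [1, 3, 4 :: nat]}"
  assumes indep: "indep_rows D (susp_triangles 1 3) (minor X)"
    and nz: "minor X [1, 2] [Inl 1, Inl 2] \<noteq> 0" "minor X [1, 2] [Inl 1, Inr 1] \<noteq> 0"
    and j: "j > 5"
  shows "lex_dependent D (susp_triangles 1 3) X [1, 2, j]"
proof -
  let ?J = "{[1, 2, 3], [1, 2, 4], [1, 2, 5 :: nat]}"
  let ?C = "{[Inl 1, Inl 2, Inr 1], [Inl 1, Inl 2, Inr 2], [Inl 1, Inl 3, Inr 1]} :: (nat + nat) list set"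
  let ?m = "\<lambda>a b. minor X [1, 2] [a, b]"
  \<comment> \<open>The coefficient of the fourth column in the relation. As it is nonzero, a
    combination that vanishes on the three columns of \<open>?C\<close> vanishes on the fourth
    too.\<close>
  let ?k = "?m (Inl 1) (Inl 2) * ?m (Inl 1) (Inr 1)"
  have pluecker: "?k * minor X [1, 2, i] [Inl 1, Inl 3, Inr 2]
      = ?m (Inl 1) (Inr 2) * ?m (Inl 1) (Inl 2) * minor X [1, 2, i] [Inl 1, Inl 3, Inr 1]
      - ?m (Inl 1) (Inr 2) * ?m (Inl 1) (Inl 3) * minor X [1, 2, i] [Inl 1, Inl 2, Inr 1]
      + ?m (Inl 1) (Inr 1) * ?m (Inl 1) (Inl 3) * minor X [1, 2, i] [Inl 1, Inl 2, Inr 2]" for i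
    by simp algebra
  have indepJ: "indep_rows ?J (susp_triangles 1 3) (minor X)"
    by (rule indep_rows_subset[OF indep]) (auto simp: D_def)
  have "\<exists>c. \<forall>t\<in>susp_triangles 1 3. minor X [1, 2, j] t = (\<Sum>s\<in>?J. c s * minor X s t)"
  proof (rule expressible_by_rows[where C' = ?C, OF _ _ _ indepJ])
    fix c d t
    assume t: "t \<in> susp_triangles 1 3"
      and 0: "\<And>u. u \<in> ?C \<Longrightarrow> d * minor X [1, 2, j] u + (\<Sum>s\<in>?J. c s * minor X s u) = 0"
    let ?L = "\<lambda>u. d * minor X [1, 2, j] u + (c [1, 2, 3] * minor X [1, 2, 3] u
      + c [1, 2, 4] * minor X [1, 2, 4] u + c [1, 2, 5] * minor X [1, 2, 5] u)"
    have sum: "d * minor X [1, 2, j] u + (\<Sum>s\<in>?J. c s * minor X s u) = ?L u" for u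
      by (simp del: minor_3)
    have "?k * ?L [Inl 1, Inl 3, Inr 2] = d * (?k * minor X [1, 2, j] [Inl 1, Inl 3, Inr 2])
      + c [1, 2, 3] * (?k * minor X [1, 2, 3] [Inl 1, Inl 3, Inr 2])
      + c [1, 2, 4] * (?k * minor X [1, 2, 4] [Inl 1, Inl 3, Inr 2])
      + c [1, 2, 5] * (?k * minor X [1, 2, 5] [Inl 1, Inl 3, Inr 2])"
      by (simp only: distrib_left mult.assoc mult.left_commute add.assoc)
    also have "\<dots> = ?m (Inl 1) (Inr 2) * ?m (Inl 1) (Inl 2) * ?L [Inl 1, Inl 3, Inr 1]
      - ?m (Inl 1) (Inr 2) * ?m (Inl 1) (Inl 3) * ?L [Inl 1, Inl 2, Inr 1]
      + ?m (Inl 1) (Inr 1) * ?m (Inl 1) (Inl 3) * ?L [Inl 1, Inl 2, Inr 2]"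
      unfolding pluecker by (simp only: algebra_simps)
    also have "\<dots> = 0"
      using 0[of "[Inl 1, Inl 3, Inr 1]"] 0[of "[Inl 1, Inl 2, Inr 1]"] 0[of "[Inl 1, Inl 2, Inr 2]"]
      unfolding sum by (simp del: minor_2 minor_3)
    finally have "?L [Inl 1, Inl 3, Inr 2] = 0"
      using nz by (simp only: mult_eq_0_iff simp_thms)
    then have last: "d * minor X [1, 2, j] [Inl 1, Inl 3, Inr 2]
        + (\<Sum>s\<in>?J. c s * minor X s [Inl 1, Inl 3, Inr 2]) = 0"
      by (simp only: sum)
    have "t \<in> ?C \<or> t = [Inl 1, Inl 3, Inr 2]"
      using t by (auto simp: susp_triangles_def)
    then show "d * minor X [1, 2, j] t + (\<Sum>s\<in>?J. c s * minor X s t) = 0"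
    proof
      assume "t \<in> ?C"
      then show ?thesis by (rule 0)
    next
      assume t: "t = [Inl 1, Inl 3, Inr 2]"
      show ?thesis unfolding t by (rule last)
    qed
  qed simp_all
  then obtain c where c: "\<forall>t\<in>susp_triangles 1 3. minor X [1, 2, j] t = (\<Sum>s\<in>?J. c s * minor X s t)"
    by (elim exE)
  show ?thesis
  proof (rule lex_dependentI[where J = ?J and c = c])
    show "lex_less (set js) (set [1, 2, j])" if "js \<in> ?J" for js
      using that j by (auto intro!: lex_less_3)
    show "minor X [1, 2, j] vs = (\<Sum>js\<in>?J. c js * minor X js vs)" if "vs \<in> susp_triangles 1 3" for vs
      using c that by blast
  qed (simp_all add: D_def)
qed

definition shifted_below_dim2 :: "nat list set" where
  "shifted_below_dim2 = {[]} \<union> (\<lambda>i. [i]) ` {1..card susp_vertices} \<union> shifted_edges"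

lemma shifted_edges_props:
  "finite shifted_edges"
  "\<forall>is\<in>shifted_edges. length is = 2 \<and> sorted_wrt (<) is \<and> set is \<subseteq> {1..card susp_vertices}"
  unfolding card_susp_vertices by (simp_all add: shifted_edges_def)

text \<open>Vertices and edges are treated alike for both suspensions; only the set \<open>T\<close>
  of triangles depends on the complex.\<close>

lemma alg_shift_suspension_eqI:
  assumes K: "abstract_simplicial_complex K" "K = set ` {[], [1], [2], [3], [4], [1, 2], [p, q]}"
    and pq: "(p, q) \<in> {(3, 4), (1, 3)}"
    and T: "finite T" "\<And>is. is \<in> T \<Longrightarrow> length is = 3 \<and> sorted_wrt (<) is \<and> set is \<subseteq> {1..6}"
    and indep: "indep_rows shifted_edges (susp_edges p q) (minor Y\<^sub>2)"
      "indep_rows T (susp_triangles p q) (minor Y\<^sub>3)"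
    and dep3: "\<And>X i j k. indep_rows T (susp_triangles p q) (minor X) \<Longrightarrow>
      (\<And>Y is vs. set is \<subseteq> {1..6} \<Longrightarrow> set vs \<subseteq> susp_vertices \<Longrightarrow> minor Y is vs \<noteq> 0 \<Longrightarrow> minor X is vs \<noteq> 0) \<Longrightarrow>
      1 \<le> i \<Longrightarrow> i < j \<Longrightarrow> j < k \<Longrightarrow> [i, j, k] \<notin> T \<Longrightarrow> lex_dependent T (susp_triangles p q) X [i, j, k]"
  shows "alg_shift (suspension K) = set ` (shifted_below_dim2 \<union> T)"
  unfolding shifted_below_dim2_def
proof (rule alg_shift_dim2_eqI[where Y\<^sub>2 = Y\<^sub>2 and Y\<^sub>3 = Y\<^sub>3])
  note props = susp_edges_props[OF pq]
  show "abstract_simplicial_complex (suspension K)"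
    unfolding suspension_def by (rule simplicial_join_complex[OF K(1) two_points_complex])
  show "suspension K =
      set ` ({[]} \<union> (\<lambda>v. [v]) ` susp_vertices \<union> susp_edges p q \<union> susp_triangles p q)"
    by (rule suspension_lists[OF K(2)])
  show "finite susp_vertices" by (simp add: susp_vertices_def)
  show "distinct vs \<and> set vs \<subseteq> susp_vertices" if "vs \<in> susp_edges p q \<union> susp_triangles p q" for vs
    using props(6) that by blast
  show "length vs = 2" if "vs \<in> susp_edges p q" for vs using props(7) that by blast
  show "length vs = 3" if "vs \<in> susp_triangles p q" for vs using props(8) that by blast
  show "finite shifted_edges" "\<And>is. is \<in> shifted_edges \<Longrightarrow> length is = 2"
    using shifted_edges_props by blast+
  show "sorted_wrt (<) is \<and> set is \<subseteq> {1..card susp_vertices}" if "is \<in> shifted_edges \<union> T" for "is"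
    using that shifted_edges_props(2) T(2) unfolding card_susp_vertices by blast
  show "length is = 3" if "is \<in> T" for "is" using T(2) that by blast
  show "lex_dependent shifted_edges (susp_edges p q) X [i, j]"
    if "indep_rows ((\<lambda>i. [i]) ` {1..card susp_vertices}) ((\<lambda>v. [v]) ` susp_vertices) (minor X)"
      "indep_rows shifted_edges (susp_edges p q) (minor X)" "1 \<le> i" "i < j" "[i, j] \<notin> shifted_edges"
    for X i j
    by (rule lex_dependent_shifted_edges[OF props(1,2) _ that]) (use props(5) in blast)
  show "lex_dependent T (susp_triangles p q) X [i, j, k]"
    if "indep_rows T (susp_triangles p q) (minor X)"
      "\<And>Y is vs. set is \<subseteq> {1..card susp_vertices} \<Longrightarrow> set vs \<subseteq> susp_vertices \<Longrightarrow>
        minor Y is vs \<noteq> 0 \<Longrightarrow> minor X is vs \<noteq> 0"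
      "1 \<le> i" "i < j" "j < k" "[i, j, k] \<notin> T" for X i j k
    by (rule dep3[OF that(1) that(2)[unfolded card_susp_vertices] that(3-6)])
qed (fact T(1) indep)+

lemma lex_less_triangles:
  assumes "js \<in> {[1, 2, 3 :: nat], [1, 2, 4], [1, 2, 5], [1, 2, 6]}" "1 \<le> i" "i < j" "j < k"
    and "[i, j, k] \<notin> {[1, 2, 3], [1, 2, 4], [1, 2, 5], [1, 2, 6]}"
  shows "lex_less (set js) (set [i, j, k])"
proof -
  have "i = 1 \<and> j = 2 \<and> k > 6 \<or> i = 1 \<and> j > 2 \<or> i > 1"
  proof (cases "i = 1 \<and> j = 2")
    case True
    then have "k \<noteq> 3 \<and> k \<noteq> 4 \<and> k \<noteq> 5 \<and> k \<noteq> 6" using assms(5) by simp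
    then show ?thesis using True assms(4) by arith
  qed (use assms(2-4) in arith)
  then show ?thesis using assms(1,3,4) by (auto intro!: lex_less_3)
qed

lemma alg_shift_suspension_two_disjoint_edges:
  "alg_shift (suspension two_disjoint_edges)
    = set ` (shifted_below_dim2 \<union> {[1, 2, 3], [1, 2, 4], [1, 2, 5], [1, 2, 6]})"
proof (rule alg_shift_suspension_eqI[where p = 3 and q = 4, OF two_disjoint_edges_complex _ _ _ _
      indep_shifted_edges_34 indep_triangles_34])
  show "two_disjoint_edges = set ` {[], [1], [2], [3], [4], [1, 2], [3, 4]}"
    by (simp add: two_disjoint_edges_def)
  fix X :: "nat \<Rightarrow> nat + nat \<Rightarrow> real" and i j k :: nat
  let ?T = "{[1, 2, 3], [1, 2, 4], [1, 2, 5], [1, 2, 6]} :: nat list set"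
  assume indep: "indep_rows ?T (susp_triangles 3 4) (minor X)"
    and ijk: "1 \<le> i" "i < j" "j < k" "[i, j, k] \<notin> ?T"
  show "lex_dependent ?T (susp_triangles 3 4) X [i, j, k]"
  proof (rule lex_dependent_last[OF _ _ _ indep])
    show "lex_less (set js) (set [i, j, k])" if "js \<in> ?T" for js
      by (rule lex_less_triangles[OF that ijk])
  qed (simp_all add: susp_edges_props)
qed auto

lemma alg_shift_suspension_shifted_edges:
  "alg_shift (suspension {{}, {1}, {2}, {3}, {4}, {1, 2}, {1, 3 :: nat}})
    = set ` (shifted_below_dim2 \<union> {[1, 2, 3], [1, 2, 4], [1, 2, 5], [1, 3, 4]})"
proof (rule alg_shift_suspension_eqI[where p = 1 and q = 3, OF _ _ _ _ _
      indep_shifted_edges_13 indep_triangles_13])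
  show "{{}, {1}, {2}, {3}, {4}, {1, 2}, {1, 3}} = set ` {[], [1], [2], [3], [4], [1, 2], [1, 3 :: nat]}"
    by simp
  have "{{}, {1}, {2}, {3}, {4}, {1, 2}, {1, 3}} = Pow {1, 2} \<union> Pow {1, 3} \<union> Pow {4 :: nat}"
    by (auto simp: Pow_insert)
  then show "abstract_simplicial_complex {{}, {1}, {2}, {3}, {4}, {1, 2}, {1, 3 :: nat}}"
    by (auto simp only: abstract_simplicial_complex_def) (auto dest: finite_subset)
  fix X :: "nat \<Rightarrow> nat + nat \<Rightarrow> real" and i j k :: nat
  let ?T = "{[1, 2, 3], [1, 2, 4], [1, 2, 5], [1, 3, 4]} :: nat list set"
  assume indep: "indep_rows ?T (susp_triangles 1 3) (minor X)"
    and generic: "\<And>Y is vs. set is \<subseteq> {1..6} \<Longrightarrow> set vs \<subseteq> susp_vertices \<Longrightarrow>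
      minor Y is vs \<noteq> 0 \<Longrightarrow> minor X is vs \<noteq> 0"
    and ijk: "1 \<le> i" "i < j" "j < k" "[i, j, k] \<notin> ?T"
  show "lex_dependent ?T (susp_triangles 1 3) X [i, j, k]"
  \<comment> \<open>Rows \<open>[1, 2, k]\<close> with \<open>k > 5\<close> lie outside
    \<open>?T\<close> but precede \<open>[1, 3, 4]\<close>, so they need the special relation; every
    other row outside \<open>?T\<close> follows all of \<open>?T\<close>.\<close>
  proof (cases "i = 1 \<and> j = 2")
    case True
    then have "k \<noteq> 3 \<and> k \<noteq> 4 \<and> k \<noteq> 5" using ijk(4) by simp
    then have "k > 5" using ijk(3) True by arith
    moreover have "minor X [1, 2] [Inl 1, v] \<noteq> 0" if "v \<in> {Inl 2, Inr 1}" for v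
      \<comment> \<open>With ones at just these two places the minor equals 1.\<close>
      by (rule generic[where Y = "\<lambda>i w. if i = 1 \<and> w = Inl 1 \<or> i = 2 \<and> w = v then 1 else 0"])
         (use that in \<open>auto simp: susp_vertices_def\<close>)
    ultimately show ?thesis using lex_dependent_triangles_13[OF indep] True by simp
  next
    case False
    have "i = 1 \<and> j = 3 \<and> k > 4 \<or> i = 1 \<and> j > 3 \<or> i > 1"
    proof (cases "i = 1 \<and> j = 3")
      case True
      then have "k \<noteq> 4" using ijk(4) by simp
      then show ?thesis using True ijk(3) by arith
    qed (use False ijk(1-3) in arith)
    then have "lex_less (set js) (set [i, j, k])" if "js \<in> ?T" for js
      using that ijk(2,3) by (auto intro!: lex_less_3)
    then show ?thesis
      by (intro lex_dependent_last[OF _ _ _ indep]) (simp_all add: susp_edges_props)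
  qed
qed auto

text \<open>A strictly sorted list is determined by its set, so the differences can be computed on
  lists, where equality is decided by simplification.\<close>

lemma set_image_sorted_diff:
  assumes "\<And>xs. xs \<in> A \<union> B \<Longrightarrow> sorted_wrt (<) (xs :: 'a::linorder list)"
  shows "set ` A - set ` B = set ` (A - B)"
proof -
  have "inj_on set (A \<union> B)"
  proof (rule inj_onI)
    fix xs ys assume "xs \<in> A \<union> B" "ys \<in> A \<union> B" "set xs = set ys"
    then show "xs = ys" using strict_sorted_equal[of ys xs] assms[of xs] assms[of ys] by simp
  qed
  then show ?thesis by (rule inj_on_image_set_diff[symmetric]) auto
qed

theorem mainTheorem8:
  shows "(\<exists>(K :: nat set set) (L :: nat set set).
            abstract_simplicial_complex K \<and> abstract_simplicial_complex L \<and> shifted L \<and>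
            alg_shift (simplicial_join K L) \<noteq> alg_shift (simplicial_join (alg_shift K) (alg_shift L))) \<and>
         alg_shift (suspension two_disjoint_edges)
           - alg_shift (suspension (alg_shift two_disjoint_edges)) = {{1, 2, 6}} \<and>
         alg_shift (suspension (alg_shift two_disjoint_edges))
           - alg_shift (suspension two_disjoint_edges) = {{1, 3, 4}}"
proof -
  let ?A = "{[1, 2, 3], [1, 2, 4], [1, 2, 5], [1, 2, 6]} :: nat list set"
  let ?B = "{[1, 2, 3], [1, 2, 4], [1, 2, 5], [1, 3, 4]} :: nat list set"
  \<comment> \<open>The length bound keeps the distinguishing triangles out of the common
    part.\<close>
  have len: "length xs < 3 \<and> sorted_wrt (<) xs" if "xs \<in> shifted_below_dim2" for xs
    using that shifted_edges_props(2) by (auto simp: shifted_below_dim2_def)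
  let ?SA = "shifted_below_dim2 \<union> ?A" and ?SB = "shifted_below_dim2 \<union> ?B"
  have lists: "?SA - ?SB = {[1, 2, 6]}" "?SB - ?SA = {[1, 3, 4]}"
    using len[of "[1, 2, 6]"] len[of "[1, 3, 4]"] by auto
  have sorted: "sorted_wrt (<) xs" if "xs \<in> ?SA \<union> ?SB" for xs
    using that len[of xs] by auto
  have "set ` ?SA - set ` ?SB = set ` (?SA - ?SB)" "set ` ?SB - set ` ?SA = set ` (?SB - ?SA)"
    by (rule set_image_sorted_diff, rule sorted, blast)+
  then have diff:
    "alg_shift (suspension two_disjoint_edges)
      - alg_shift (suspension (alg_shift two_disjoint_edges)) = {{1, 2, 6}}"
    "alg_shift (suspension (alg_shift two_disjoint_edges))
      - alg_shift (suspension two_disjoint_edges) = {{1, 3, 4}}"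
    unfolding alg_shift_two_disjoint_edges alg_shift_suspension_two_disjoint_edges
      alg_shift_suspension_shifted_edges lists by simp_all
  then have "alg_shift (simplicial_join two_disjoint_edges two_points)
      \<noteq> alg_shift (simplicial_join (alg_shift two_disjoint_edges) (alg_shift two_points))"
    unfolding alg_shift_two_points suspension_def by auto
  with two_disjoint_edges_complex two_points_complex two_points_shifted diff show ?thesis
    by blast
qed

end
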